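(* Let $d,u\in\mathbb{N}_0$ with $d\ge u$, let $c_1,\ldots,c_d\in\mathbb{N}\setminus\{2\}$ with $c_1\ge3$ if $u\ge1$, and let $z_0,\ldots,z_d\in\mathbb{C}$ with $|z_j|<1$. With $c_0=1$, $c_{d+1}=0$, $\delta_i=\delta(c_i)+\delta(c_{i+1})$, $k_{-1}=0$, $$\sum_{\substack{a_0,\ldots,a_d\geq0\\ a_u\geq1}}t^{\star}(\{2\}^{a_0},c_1,\{2\}^{a_1},\ldots,c_d,\{2\}^{a_d})z_0^{2a_0}\cdots z_d^{2a_d}=z_u^2\cdot\frac{2}{\pi}\sum_{k_0\geq\cdots\geq k_d\geq1}\frac{1}{(2k_u-1)^2}\prod_{i=0}^{d}\frac{(-1)^{k_i\delta_i}(2k_i-1)^{\delta_i-1}}{(2k_i-1)^2-z_i^2}V_{k_{i-1},k_i}^{\#}(\{1\}^{c_i-3}).$$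
   Context: For an index $\boldsymbol{s}=(s_1,\ldots,s_r)$ of positive integers with $s_1>1$ (or empty), $t^{\star}(\boldsymbol{s})=\sum_{k_1\geq\cdots\geq k_r\geq1}\prod_{j=1}^r(2k_j-1)^{-s_j}$, $t^\star(\emptyset)=1$. $\{s\}^a$ denotes $s$ repeated $a$ times; for $a\le0$, $\{1\}^a$ is empty. $\triangle(k,m)=0$ if $k=m$, $1$ otherwise. For an index $\boldsymbol{s}=(s_1,\ldots,s_r)$ and $k,m\in\mathbb{N}_0$: if $\boldsymbol{s}\ne\emptyset$ and $k\ge m$, $V^{\#}_{k,m}(\boldsymbol{s})=\frac{2k-1}{2m-1}\sum_{k\geq l_1\geq\cdots\geq l_r\geq m}\frac{2^{\triangle(k,l_1)+\triangle(l_1,l_2)+\cdots+\triangle(l_r,m)}}{(2l_1-1)^{s_1}\cdots(2l_r-1)^{s_r}}$; otherwise $V^{\#}_{k,m}(\boldsymbol{s})=\left(2\cdot\frac{2k-1}{2m-1}\right)^{\triangle(k,m)}$. $\delta(0)=2$, $\delta(1)=1$, $\delta(c)=0$ for $c\ge3$. *)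

theory Defs
  imports "HOL-Analysis.Analysis"
begin

text \<open>Odd-number value 2k-1 as a real (for k = 0 this is -1).\<close>
definition oddr :: "nat \<Rightarrow> real" where
  "oddr k = 2 * real k - 1"

definition tstar :: "nat list \<Rightarrow> real" where
  "tstar s = infsum (\<lambda>ks. \<Prod>j<length s. 1 / oddr (ks ! j) ^ (s ! j))
      {ks :: nat list. length ks = length s \<and> sorted_wrt (\<ge>) ks \<and> (\<forall>k\<in>set ks. 1 \<le> k)}"

definition tri :: "nat \<Rightarrow> nat \<Rightarrow> nat" where
  "tri k m = (if k = m then 0 else 1)"

fun tri_chain :: "nat list \<Rightarrow> nat" where
  "tri_chain (x # y # zs) = tri x y + tri_chain (y # zs)"
| "tri_chain _ = 0"

definition Vsharp :: "nat \<Rightarrow> nat \<Rightarrow> nat list \<Rightarrow> real" where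
  "Vsharp k m s =
     (if s \<noteq> [] \<and> m \<le> k then
        oddr k / oddr m *
        (\<Sum>ls\<in>{ls :: nat list. length ls = length s \<and> sorted_wrt (\<ge>) (k # ls @ [m])}.
            2 ^ tri_chain (k # ls @ [m]) / (\<Prod>j<length s. oddr (ls ! j) ^ (s ! j)))
      else (2 * oddr k / oddr m) ^ tri k m)"

text \<open>delta(0) = 2, delta(1) = 1, delta(c) = 0 for c \<ge> 3 (the value at 2 is never used).\<close>
definition dlt :: "nat \<Rightarrow> nat" where
  "dlt c = (if c = 0 then 2 else if c = 1 then 1 else 0)"

definition idx :: "nat \<Rightarrow> (nat \<Rightarrow> nat) \<Rightarrow> nat list \<Rightarrow> nat list" where
  "idx d c as = replicate (as ! 0) 2 @ concat (map (\<lambda>i. c i # replicate (as ! i) 2) [1..<d+1])"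

definition cext :: "nat \<Rightarrow> (nat \<Rightarrow> nat) \<Rightarrow> nat \<Rightarrow> nat" where
  "cext d c i = (if i = 0 then 1 else if i = d + 1 then 0 else c i)"

end

theory Submission
  imports Defs "HOL-Real_Asymp.Real_Asymp"
begin

text \<open>
  Truncate the outermost summation variable at n and write every truncated value as
  T g n, where T is the sum of the first n values of g against the coefficients A(n, k) of the partial fraction
  expansion of the product of 1 / (1 - w^2/(2j-1)^2) over j = 1..n. Let S_c be the operator sending f to
  the sequence of partial sums of f(m) / (2m-1)^c. Then T diagonalises S_2, namely
  S_2 T g = T (g/(2k-1)^2), and division by 2n-1 corresponds under T to an explicit triangular matrix X, whose
  powers are the V-sharp sums and whose inverse has the same entries up to signs and factors
  2k-1. Hence S_c T = T (2k-1)^(-2) X^(c-2), also for c = 1, and by induction on d the truncated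
  t-star value is T of an explicit finite sum over the chains below k_0. Wallis' product gives the limit
  of A(n, k), Tannery's theorem lets n tend to infinity, and the sums over the exponents a_i are
  geometric series.
\<close>

section \<open>Partial fraction coefficients\<close>

text \<open>The expansion enters because the truncated values for {2}^a are the complete homogeneous
  symmetric sums of the numbers 1/(2j-1)^2: their generating function in w^2 is the product of the
  overview, and its partial fractions turn every further 2 into a factor 1/(2k-1)^2. An entry c
  other than 2 must divide by a power of 2n-1, which depends on n and not on k. The ratio of
  neighbouring coefficients A(n, k) is so simple that the sums needed for this telescope, and
  multiplication by (2n-1)^(+-1) carries A(n, m) into a combination of A(n, k) with k >= m. The
  obstacle is absolute convergence, needed for the limit and for exchanging the sums over exponents
  and over chains. The limiting coefficient decays only like 1/(2k_0-1). If u = 0, the condition a_0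
  >= 1 supplies 1/(2k_0-1)^2. If u >= 1, then a_0 may be 0 and the factor 1/(2k_u-1)^2 gives no
  decay in k_0; there c_1 >= 3 supplies another 1/(2k_0-1). All other losses are powers of odd
  harmonic numbers, hence of logarithms.\<close>

lemma oddr_ge_1: "1 \<le> k \<Longrightarrow> 1 \<le> oddr k"
  by (simp add: oddr_def)

lemma oddr_pos: "1 \<le> k \<Longrightarrow> 0 < oddr k"
  by (simp add: oddr_def)

lemma oddr_nonzero: "oddr k \<noteq> 0"
proof
  assume "oddr k = 0"
  hence "real (2 * k) = real 1" by (simp add: oddr_def)
  hence "2 * k = 1" unfolding of_nat_eq_iff .
  thus False by presburger
qed

text \<open>This is A(n, 1): for k = 1 the subtracted square is 1. The other coefficients are
  reached from it through ratios in k.\<close>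

definition wallis_prod :: "nat \<Rightarrow> real" where
  "wallis_prod n = (\<Prod>j\<in>{2..n}. oddr j ^ 2 / (oddr j ^ 2 - 1))"

text \<open>
  Up to the factor (-1)^(k+1) / (2k-1), the product of (2j-1)^2 / ((2j-1)^2 - (2k-1)^2) over
  j = 1..n with j different from k. This form makes the ratio in k explicit, and it vanishes for k > n \<ge> 1.
\<close>
definition pf_weight :: "nat \<Rightarrow> nat \<Rightarrow> real" where
  "pf_weight n k = wallis_prod n * (\<Prod>j\<in>{1..<k}. (real n - real j) / (real n + real j))"

definition pf_coeff :: "nat \<Rightarrow> nat \<Rightarrow> real" where
  "pf_coeff n k = (-1) ^ Suc k / oddr k * pf_weight n k"

definition pf_sum :: "(nat \<Rightarrow> real) \<Rightarrow> nat \<Rightarrow> real" where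
  "pf_sum g n = (\<Sum>k\<in>{1..n}. pf_coeff n k * g k)"

lemma pf_sum_cong: "(\<And>k. 1 \<le> k \<Longrightarrow> k \<le> n \<Longrightarrow> f k = g k) \<Longrightarrow> pf_sum f n = pf_sum g n"
  unfolding pf_sum_def by (intro sum.cong) auto

lemma wallis_prod_Suc: "1 \<le> n \<Longrightarrow>
  wallis_prod (Suc n) * (1 - 1 / oddr (Suc n) ^ 2) = wallis_prod n"
proof -
  assume n: "1 \<le> n"
  have "oddr (Suc n) > 1" using n by (simp add: oddr_def)
  hence "oddr (Suc n) ^ 2 > 1" by simp
  moreover have "{2..Suc n} = insert (Suc n) {2..n}" using n by auto
  ultimately have "wallis_prod (Suc n) = oddr (Suc n) ^ 2 / (oddr (Suc n) ^ 2 - 1) * wallis_prod n"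
    by (simp add: wallis_prod_def)
  moreover have "x / (x - 1) * y * (1 - 1 / x) = y" if "x > 1" for x y :: real
    using that by (simp add: field_simps)
  ultimately show ?thesis using \<open>oddr (Suc n) ^ 2 > 1\<close> by metis
qed

lemma pf_weight_Suc: "1 \<le> k \<Longrightarrow>
  pf_weight n (Suc k) = pf_weight n k * ((real n - real k) / (real n + real k))"
  by (simp add: pf_weight_def atLeastLessThanSuc mult.assoc)

text \<open>All telescoping sums over k below rest on this two-term recurrence. In the cleared form
  it can be rewritten in either direction, also at k = n, where the right side vanishes.\<close>

lemma pf_coeff_ratio: "1 \<le> k \<Longrightarrow>
  pf_coeff n (Suc k) * oddr (Suc k) * (real n + real k) =
    - pf_coeff n k * oddr k * (real n - real k)"
  unfolding pf_coeff_def
  using oddr_nonzero[of k] oddr_nonzero[of "Suc k"] by (simp add: pf_weight_Suc)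

text \<open>Passing from n to n + 1 adds the factor j = n + 1 to the product. With the factor on the
  side of \<open>Suc n\<close> the identity also covers k = n + 1, where both sides are 0.\<close>

lemma pf_weight_step:
  assumes "1 \<le> k" "1 \<le> n"
  shows "pf_weight (Suc n) k * (1 - oddr k ^ 2 / oddr (Suc n) ^ 2) = pf_weight n k"
  using assms(1)
proof (induction k rule: dec_induct)
  case base
  show ?case using wallis_prod_Suc[OF assms(2)] by (simp add: pf_weight_def oddr_def)
next
  case (step k)
  let ?N = "oddr (Suc n)" and ?n = "real n" and ?k = "real k"
  have N: "?N \<noteq> 0" by (rule oddr_nonzero)
  have 1: "?n + ?k \<noteq> 0" "?n + 1 + ?k \<noteq> 0" using assms by linarith+
  \<comment> \<open>Differences of squares: 2n+1 and 2k-1 differ by 2(n+1-k) and add up to 2(n+k).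
    The two factorisations share exactly the terms that the ratios in k exchange.\<close>
  have eq1: "1 - oddr k ^ 2 / ?N ^ 2 = 4 * (?n + 1 - ?k) * (?n + ?k) / ?N ^ 2"
    using N by (simp add: field_simps) (simp add: oddr_def power2_eq_square algebra_simps)
  have eq2: "1 - oddr (Suc k) ^ 2 / ?N ^ 2 = 4 * (?n - ?k) * (?n + 1 + ?k) / ?N ^ 2"
    using N by (simp add: field_simps) (simp add: oddr_def power2_eq_square algebra_simps)
  have "pf_weight (Suc n) (Suc k) * (1 - oddr (Suc k) ^ 2 / ?N ^ 2) =
      pf_weight (Suc n) k * ((?n + 1 - ?k) / (?n + 1 + ?k)) * (4 * (?n - ?k) * (?n + 1 + ?k) / ?N ^ 2)"
    unfolding eq2 using step by (simp add: pf_weight_Suc add_ac)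
  also have "\<dots> = pf_weight (Suc n) k * (4 * (?n + 1 - ?k) * (?n + ?k) / ?N ^ 2) * ((?n - ?k) / (?n + ?k))"
  proof -
    have "p * (a / b) * (4 * x * b / M) = p * (4 * a * y / M) * (x / y)"
      if "b \<noteq> 0" "y \<noteq> 0" for p a b x y M :: real
      using that by (simp add: field_simps)
    from this[OF 1(2,1)] show ?thesis .
  qed
  also have "\<dots> = pf_weight n k * ((?n - ?k) / (?n + ?k))"
    using step unfolding eq1 by simp
  also have "\<dots> = pf_weight n (Suc k)"
    using step by (simp add: pf_weight_Suc)
  finally show ?case .
qed

lemma pf_coeff_step:
  assumes "1 \<le> k" "1 \<le> n"
  shows "pf_coeff (Suc n) k * (1 - oddr k ^ 2 / oddr (Suc n) ^ 2) = pf_coeff n k"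
  unfolding pf_coeff_def pf_weight_step[OF assms, symmetric] by simp

lemma pf_coeff_Suc_self: "1 \<le> n \<Longrightarrow> pf_coeff n (Suc n) = 0"
  by (simp add: pf_coeff_def pf_weight_Suc)

text \<open>For n >= 2 the product decays at least like w^(-4), so the coefficient of w^(-2) in its
  partial fractions is zero.\<close>

lemma sum_pf_coeff_odd_sq:
  assumes "2 \<le> n"
  shows "(\<Sum>k\<in>{1..n}. pf_coeff n k * oddr k ^ 2) = 0"
proof -
  \<comment> \<open>A closed form for all partial sums, which makes the induction go through; the
    factor n - l kills it at l = n, and n - 1 is then cancelled.\<close>
  have "(real n - 1) * (\<Sum>k\<in>{1..l}. pf_coeff n k * oddr k ^ 2) =
      pf_coeff n l * oddr l * (real n - real l) * real l" if "1 \<le> l" for l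
    using that
  proof (induction l rule: dec_induct)
    case base
    show ?case by (simp add: oddr_def)
  next
    case (step l)
    have "(real n - 1) * (\<Sum>k\<in>{1..Suc l}. pf_coeff n k * oddr k ^ 2) =
      - (pf_coeff n (Suc l) * oddr (Suc l) * (real n + real l)) * real l
       + (real n - 1) * (pf_coeff n (Suc l) * oddr (Suc l) ^ 2)"
      using step pf_coeff_ratio[of l n] by (simp add: distrib_left)
    also have "\<dots> = pf_coeff n (Suc l) * oddr (Suc l) * (real n - real (Suc l)) * real (Suc l)"
      by (simp add: oddr_def power2_eq_square algebra_simps)
    finally show ?case .
  qed
  from this[of n] assms show ?thesis by auto
qed

text \<open>This is the partial fraction expansion at w = 0. In the induction step the range can be
  extended for free because A(n, n+1) = 0, and the correction term is the vanishing sum of the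
  preceding lemma.\<close>

lemma pf_sum_one: "1 \<le> n \<Longrightarrow> pf_sum (\<lambda>_. 1) n = 1"
proof (induction n rule: dec_induct)
  case base
  show ?case by (simp add: pf_sum_def pf_coeff_def pf_weight_def wallis_prod_def oddr_def)
next
  case (step n)
  have "1 = (\<Sum>k\<in>{1..n}. pf_coeff n k)" using step by (simp add: pf_sum_def)
  also have "\<dots> = (\<Sum>k\<in>{1..Suc n}. pf_coeff n k)"
    using step by (simp add: pf_coeff_Suc_self)
  also have "\<dots> = (\<Sum>k\<in>{1..Suc n}. pf_coeff (Suc n) k * (1 - oddr k ^ 2 / oddr (Suc n) ^ 2))"
    using step by (intro sum.cong) (auto simp: pf_coeff_step)
  also have "\<dots> = (\<Sum>k\<in>{1..Suc n}. pf_coeff (Suc n) k)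
      - (\<Sum>k\<in>{1..Suc n}. pf_coeff (Suc n) k * oddr k ^ 2) / oddr (Suc n) ^ 2"
    by (simp add: right_diff_distrib sum_subtractf sum_divide_distrib del: sum.cl_ivl_Suc)
  also have "\<dots> = (\<Sum>k\<in>{1..Suc n}. pf_coeff (Suc n) k)"
    using step by (subst sum_pf_coeff_odd_sq) auto
  finally show ?case by (simp add: pf_sum_def)
qed

section \<open>Action of summation and of multiplication by powers of 2n-1\<close>

lemma sum_pf_sum_div_sq:
  "(\<Sum>m\<in>{1..n}. pf_sum g m / oddr m ^ 2) = pf_sum (\<lambda>k. g k / oddr k ^ 2) n"
proof (induction n)
  case 0
  show ?case by (simp add: pf_sum_def)
next
  case (Suc n)
  \<comment> \<open>The recursion in n says that the increment of A(n, k) / (2k-1)^2 is A(n+1, k) /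
    (2n+1)^2, so the sum over m telescopes.\<close>
  have "pf_coeff n k * (g k / oddr k ^ 2) + pf_coeff (Suc n) k * g k / oddr (Suc n) ^ 2
      = pf_coeff (Suc n) k * (g k / oddr k ^ 2)" if "k \<in> {1..n}" for k
  proof -
    have "pf_coeff n k = pf_coeff (Suc n) k * (1 - oddr k ^ 2 / oddr (Suc n) ^ 2)"
      using that by (simp add: pf_coeff_step)
    show ?thesis unfolding \<open>pf_coeff n k = _\<close> using oddr_nonzero[of k] oddr_nonzero[of "Suc n"]
      by (simp add: field_simps)
  qed
  hence "(\<Sum>k\<in>{1..n}. pf_coeff n k * (g k / oddr k ^ 2)) +
      (\<Sum>k\<in>{1..n}. pf_coeff (Suc n) k * g k / oddr (Suc n) ^ 2) =
      (\<Sum>k\<in>{1..n}. pf_coeff (Suc n) k * (g k / oddr k ^ 2))"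
    by (simp add: sum.distrib[symmetric])
  thus ?case using Suc by (simp add: pf_sum_def sum_divide_distrib add_divide_distrib)
qed

lemma tri_self: "tri k k = 0" by (simp add: tri_def)

lemma two_pow_tri: "(2::real) ^ tri k m = (if k = m then 1 else 2)"
  by (simp add: tri_def)

text \<open>Reduces an operator identity to one on coefficients at a fixed n: \<open>r\<close> is a
  scalar, and the matrix that expands r A(n, m) in the A(n, k) acts on g after the triangular double
  sum is swapped.\<close>

lemma pf_sum_triangular:
  assumes "\<And>m. 1 \<le> m \<Longrightarrow> m \<le> n \<Longrightarrow> pf_coeff n m * r = (\<Sum>k\<in>{m..n}. pf_coeff n k * X k m)"
  shows "pf_sum g n * r = pf_sum (\<lambda>k. \<Sum>m\<in>{1..k}. X k m * g m) n"
proof -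
  have "pf_sum g n * r = (\<Sum>m\<in>{1..n}. pf_coeff n m * r * g m)"
    by (simp add: pf_sum_def sum_distrib_left mult_ac)
  also have "\<dots> = (\<Sum>m\<in>{1..n}. \<Sum>k\<in>{m..n}. pf_coeff n k * X k m * g m)"
    using assms by (intro sum.cong) (auto simp: sum_distrib_right)
  also have "\<dots> = (\<Sum>k\<in>{1..n}. \<Sum>m\<in>{1..k}. pf_coeff n k * X k m * g m)"
    by (subst (1 2) sum.Sigma) (auto intro!: sum.reindex_bij_witness[of _ "\<lambda>(a,b). (b,a)" "\<lambda>(a,b). (b,a)"])
  also have "\<dots> = pf_sum (\<lambda>k. \<Sum>m\<in>{1..k}. X k m * g m) n"
    by (simp add: pf_sum_def sum_distrib_left mult_ac)
  finally show ?thesis .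
qed

lemma pf_sum_div_odd:
  "pf_sum g n / oddr n = pf_sum (\<lambda>k. \<Sum>m\<in>{1..k}. 2 ^ tri k m * oddr k / oddr m ^ 2 * g m) n"
proof -
  \<comment> \<open>The tail is evaluated from its upper end: at m = n both sides vanish, and in the
    step 2m+1 plus 2n-1 is 2(n+m), the factor that the recurrence in k absorbs.\<close>
  have tail: "(\<Sum>k\<in>{Suc m..n}. 2 * pf_coeff n k * oddr k) = pf_coeff n m * oddr m * (oddr m / oddr n - 1)"
    if "1 \<le> m" "m \<le> n" for m
    using that(2,1)
  proof (induction m rule: inc_induct)
    case base
    show ?case using oddr_nonzero[of n] by simp
  next
    case (step m)
    have "{Suc m..n} = insert (Suc m) {Suc (Suc m)..n}" using step by auto
    hence "(\<Sum>k\<in>{Suc m..n}. 2 * pf_coeff n k * oddr k) =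
        pf_coeff n (Suc m) * oddr (Suc m) * (oddr (Suc m) / oddr n + 1)"
      using step by (simp add: algebra_simps)
    also have "oddr (Suc m) / oddr n + 1 = 2 * (real n + real m) / oddr n"
      using oddr_nonzero[of n] by (simp add: field_simps) (simp add: oddr_def)
    also have "pf_coeff n (Suc m) * oddr (Suc m) * (2 * (real n + real m) / oddr n) =
        2 * (pf_coeff n (Suc m) * oddr (Suc m) * (real n + real m)) / oddr n" by simp
    also have "\<dots> = pf_coeff n m * oddr m * (- 2 * (real n - real m) / oddr n)"
      using step by (subst pf_coeff_ratio) (auto simp: algebra_simps)
    also have "- 2 * (real n - real m) / oddr n = oddr m / oddr n - 1"
      using oddr_nonzero[of n] by (simp add: field_simps) (simp add: oddr_def)
    finally show ?case .
  qed
  have "pf_coeff n m * (1 / oddr n) = (\<Sum>k\<in>{m..n}. pf_coeff n k * (2 ^ tri k m * oddr k / oddr m ^ 2))"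
    if m: "1 \<le> m" "m \<le> n" for m
  proof -
    have "{m..n} = insert m {Suc m..n}" using m by auto
    hence "(\<Sum>k\<in>{m..n}. pf_coeff n k * (2 ^ tri k m * oddr k / oddr m ^ 2)) =
       pf_coeff n m * oddr m / oddr m ^ 2 + (\<Sum>k\<in>{Suc m..n}. pf_coeff n k * (2 ^ tri k m * oddr k / oddr m ^ 2))"
      by (simp add: tri_self)
    also have "(\<Sum>k\<in>{Suc m..n}. pf_coeff n k * (2 ^ tri k m * oddr k / oddr m ^ 2)) =
        (\<Sum>k\<in>{Suc m..n}. 2 * pf_coeff n k * oddr k) / oddr m ^ 2"
      unfolding sum_divide_distrib by (intro sum.cong) (auto simp: two_pow_tri)
    also have "pf_coeff n m * oddr m / oddr m ^ 2 + \<dots> = pf_coeff n m * (1 / oddr n)"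
      unfolding tail[OF m] using oddr_nonzero[of m] oddr_nonzero[of n]
      by (simp add: field_simps power2_eq_square)
    finally show ?thesis by simp
  qed
  from pf_sum_triangular[OF this, of g] show ?thesis by simp
qed

text \<open>Needed for c = 1, where dividing by 2m-1 means multiplying by 2m-1 and then dividing by
  its square. The sign (-1)^k cancels the alternation of A(n, k), and the same downward telescoping
  applies.\<close>

lemma pf_sum_mult_odd:
  "pf_sum g n * oddr n =
    pf_sum (\<lambda>k. \<Sum>m\<in>{1..k}. (-1) ^ (k + m) * 2 ^ tri k m * oddr k ^ 2 / oddr m * g m) n"
proof (rule pf_sum_triangular)
  fix m assume m: "1 \<le> m" "m \<le> n"
  have tail: "(\<Sum>k\<in>{Suc m..n}. 2 * (-1) ^ k * pf_coeff n k * oddr k ^ 2) =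
      (-1) ^ m * pf_coeff n m * oddr m * (oddr n - oddr m)"
    using m(2,1)
  proof (induction m rule: inc_induct)
    case base
    show ?case by simp
  next
    case (step m)
    have "{Suc m..n} = insert (Suc m) {Suc (Suc m)..n}" using step by auto
    hence "(\<Sum>k\<in>{Suc m..n}. 2 * (-1) ^ k * pf_coeff n k * oddr k ^ 2) =
        (-1) ^ Suc m * (pf_coeff n (Suc m) * oddr (Suc m)) * (oddr n + oddr (Suc m))"
      using step by (simp add: algebra_simps power2_eq_square)
    also have "oddr n + oddr (Suc m) = 2 * (real n + real m)" by (simp add: oddr_def)
    also have "(-1) ^ Suc m * (pf_coeff n (Suc m) * oddr (Suc m)) * (2 * (real n + real m)) =
        2 * (-1) ^ Suc m * (pf_coeff n (Suc m) * oddr (Suc m) * (real n + real m))" by simp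
    also have "\<dots> = (-1) ^ m * pf_coeff n m * oddr m * (2 * (real n - real m))"
      using step by (subst pf_coeff_ratio) auto
    also have "2 * (real n - real m) = oddr n - oddr m" by (simp add: oddr_def)
    finally show ?case .
  qed
  have sq: "(-1) ^ m * (-1) ^ m = (1::real)" by (simp flip: power_add)
  have "{m..n} = insert m {Suc m..n}" using m by auto
  hence "(\<Sum>k\<in>{m..n}. pf_coeff n k * ((-1) ^ (k + m) * 2 ^ tri k m * oddr k ^ 2 / oddr m)) =
     pf_coeff n m * oddr m + (\<Sum>k\<in>{Suc m..n}. pf_coeff n k * ((-1) ^ (k + m) * 2 ^ tri k m * oddr k ^ 2 / oddr m))"
    using oddr_nonzero[of m] by (simp add: tri_self power2_eq_square sq power_add)
  also have "(\<Sum>k\<in>{Suc m..n}. pf_coeff n k * ((-1) ^ (k + m) * 2 ^ tri k m * oddr k ^ 2 / oddr m)) =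
      (\<Sum>k\<in>{Suc m..n}. 2 * (-1) ^ k * pf_coeff n k * oddr k ^ 2) * (-1) ^ m / oddr m"
    unfolding sum_divide_distrib sum_distrib_right
    by (intro sum.cong) (auto simp: two_pow_tri power_add)
  also have "\<dots> = ((-1) ^ m * (-1) ^ m) * pf_coeff n m * (oddr n - oddr m)"
    unfolding tail using oddr_nonzero[of m] by (simp add: mult_ac)
  also have "pf_coeff n m * oddr m + \<dots> = pf_coeff n m * oddr n"
    unfolding sq by (simp add: algebra_simps)
  finally show "pf_coeff n m * oddr n =
    (\<Sum>k\<in>{m..n}. pf_coeff n k * ((-1) ^ (k + m) * 2 ^ tri k m * oddr k ^ 2 / oddr m))" by simp
qed

lemma sum_Cons_Sigma:
  fixes f :: "'a list \<Rightarrow> 'b :: comm_monoid_add"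
  assumes "finite I" "\<And>m. m \<in> I \<Longrightarrow> finite (S m)"
  shows "sum f ((\<lambda>(m, ks). m # ks) ` Sigma I S) = (\<Sum>m\<in>I. \<Sum>ks\<in>S m. f (m # ks))"
  using assms
  by (subst sum.reindex) (auto simp: inj_on_def sum.Sigma case_prod_unfold)

section \<open>Powers of the triangular matrix\<close>

definition desc_between :: "nat \<Rightarrow> nat \<Rightarrow> nat \<Rightarrow> nat list set" where
  "desc_between r k m = {ls. length ls = r \<and> sorted_wrt (\<ge>) (k # ls @ [m])}"

lemma desc_between_0: "m \<le> k \<Longrightarrow> desc_between 0 k m = {[]}"
  by (auto simp: desc_between_def)

lemma desc_between_Suc:
  "desc_between (Suc r) k m = (\<lambda>(l, ls). l # ls) ` (SIGMA l:{m..k}. desc_between r l m)"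
proof (intro set_eqI iffI)
  fix x assume "x \<in> desc_between (Suc r) k m"
  thus "x \<in> (\<lambda>(l, ls). l # ls) ` (SIGMA l:{m..k}. desc_between r l m)"
    by (cases x) (auto simp: desc_between_def)
next
  fix x assume "x \<in> (\<lambda>(l, ls). l # ls) ` (SIGMA l:{m..k}. desc_between r l m)"
  thus "x \<in> desc_between (Suc r) k m"
    by (fastforce simp: desc_between_def)
qed

lemma finite_desc_between: "finite (desc_between r k m)"
proof (induction r arbitrary: k)
  case 0
  have "desc_between 0 k m \<subseteq> {[]}" by (auto simp: desc_between_def)
  thus ?case by (rule finite_subset) simp
qed (simp add: desc_between_Suc)

text \<open>Brings the separate default branch for the empty index under the general formula: for r
  = 0 the only list is \<open>[]\<close>, and the chain reduces to the link from k to m.\<close>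

lemma Vsharp_ones:
  assumes "m \<le> k"
  shows "Vsharp k m (replicate r 1) = oddr k / oddr m *
    (\<Sum>ls\<in>desc_between r k m. 2 ^ tri_chain (k # ls @ [m]) / (\<Prod>j<r. oddr (ls ! j)))"
proof (cases r)
  case 0
  show ?thesis
    using assms oddr_nonzero[of m] unfolding 0 desc_between_0[OF assms]
    by (simp add: Vsharp_def tri_def)
next
  case (Suc r')
  show ?thesis
    using assms unfolding Vsharp_def desc_between_def Suc
    by (auto intro!: sum.cong arg_cong2[where f = "(/)"] prod.cong simp del: replicate_Suc)
qed

lemma Vsharp_ones_0: "m \<le> k \<Longrightarrow> Vsharp k m [] = 2 ^ tri k m * oddr k / oddr m"
  using oddr_nonzero[of m] by (simp add: Vsharp_def tri_def)

text \<open>This is matrix multiplication: splitting off the largest inner variable l, one factor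
  1/(2l-1) is its own weight and the other cancels the prefactor of the shorter chain. Hence V-sharp
  of {1}^r divided by 2m-1 is the entry of the power r + 1.\<close>

lemma Vsharp_ones_Suc:
  assumes "m \<le> k"
  shows "Vsharp k m (replicate (Suc r) 1) =
    (\<Sum>l\<in>{m..k}. 2 ^ tri k l * oddr k / oddr l ^ 2 * Vsharp l m (replicate r 1))"
proof -
  have "Vsharp k m (replicate (Suc r) 1) = oddr k / oddr m *
      (\<Sum>l\<in>{m..k}. \<Sum>ls\<in>desc_between r l m.
        2 ^ tri_chain (k # (l # ls) @ [m]) / (\<Prod>j<Suc r. oddr ((l # ls) ! j)))"
    unfolding Vsharp_ones[OF assms] desc_between_Suc
    by (subst sum_Cons_Sigma) (auto simp: finite_desc_between)
  also have "\<dots> = (\<Sum>l\<in>{m..k}. 2 ^ tri k l * oddr k / oddr l ^ 2 * (oddr l / oddr m *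
      (\<Sum>ls\<in>desc_between r l m. 2 ^ tri_chain (l # ls @ [m]) / (\<Prod>j<r. oddr (ls ! j)))))"
    unfolding sum_distrib_left using oddr_nonzero
    by (intro sum.cong refl)
       (simp add: prod.lessThan_Suc_shift power_add power2_eq_square mult_ac del: prod.lessThan_Suc)
  also have "\<dots> = (\<Sum>l\<in>{m..k}. 2 ^ tri k l * oddr k / oddr l ^ 2 * Vsharp l m (replicate r 1))"
    by (intro sum.cong refl, subst Vsharp_ones) auto
  finally show ?thesis .
qed

lemma sum_triangle_swap:
  fixes f :: "nat \<Rightarrow> nat \<Rightarrow> real"
  shows "(\<Sum>l\<in>{1..k}. \<Sum>m\<in>{1..l}. f l m) = (\<Sum>m\<in>{1..k}. \<Sum>l\<in>{m..k}. f l m)"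
  by (subst (1 2) sum.Sigma)
     (auto intro!: sum.reindex_bij_witness[of _ "\<lambda>(a,b). (b,a)" "\<lambda>(a,b). (b,a)"])

lemma pf_sum_div_odd_pow:
  "pf_sum g n / oddr n ^ Suc r =
    pf_sum (\<lambda>k. \<Sum>m\<in>{1..k}. Vsharp k m (replicate r 1) / oddr m * g m) n"
proof (induction r)
  case 0
  show ?case
    by (simp add: pf_sum_div_odd) (intro pf_sum_cong sum.cong refl, simp add: Vsharp_ones_0 power2_eq_square)
next
  case (Suc r)
  have "pf_sum g n / oddr n ^ Suc (Suc r) = pf_sum g n / oddr n ^ Suc r / oddr n" by simp
  also have "\<dots> = pf_sum (\<lambda>k. \<Sum>l\<in>{1..k}. 2 ^ tri k l * oddr k / oddr l ^ 2 *
      (\<Sum>m\<in>{1..l}. Vsharp l m (replicate r 1) / oddr m * g m)) n"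
    unfolding Suc by (rule pf_sum_div_odd)
  also have "\<dots> = pf_sum (\<lambda>k. \<Sum>m\<in>{1..k}. Vsharp k m (replicate (Suc r) 1) / oddr m * g m) n"
  proof (rule pf_sum_cong)
    fix k
    have "(\<Sum>l\<in>{1..k}. 2 ^ tri k l * oddr k / oddr l ^ 2 *
        (\<Sum>m\<in>{1..l}. Vsharp l m (replicate r 1) / oddr m * g m)) =
      (\<Sum>m\<in>{1..k}. \<Sum>l\<in>{m..k}. 2 ^ tri k l * oddr k / oddr l ^ 2 *
        (Vsharp l m (replicate r 1) / oddr m * g m))"
      unfolding sum_distrib_left by (rule sum_triangle_swap)
    also have "\<dots> = (\<Sum>m\<in>{1..k}. Vsharp k m (replicate (Suc r) 1) / oddr m * g m)"
      by (intro sum.cong refl, subst Vsharp_ones_Suc)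
         (simp_all add: sum_distrib_left sum_distrib_right sum_divide_distrib mult_ac del: replicate_Suc)
    finally show "(\<Sum>l\<in>{1..k}. 2 ^ tri k l * oddr k / oddr l ^ 2 *
        (\<Sum>m\<in>{1..l}. Vsharp l m (replicate r 1) / oddr m * g m)) =
      (\<Sum>m\<in>{1..k}. Vsharp k m (replicate (Suc r) 1) / oddr m * g m)" .
  qed
  finally show ?case .
qed

text \<open>The entries of X^(c-2); for c = 1 this is the inverse of X.\<close>
definition kern :: "nat \<Rightarrow> nat \<Rightarrow> nat \<Rightarrow> real" where
  "kern c k m = (if c = 1 then (-1) ^ (k + m) * oddr k * Vsharp k m []
     else Vsharp k m (replicate (c - 3) 1) / oddr m)"

lemma sum_pf_sum_div_pow:
  assumes "1 \<le> c" "c \<noteq> 2"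
  shows "(\<Sum>m\<in>{1..n}. pf_sum g m / oddr m ^ c) =
    pf_sum (\<lambda>k. (\<Sum>m\<in>{1..k}. kern c k m * g m) / oddr k ^ 2) n"
proof -
  have "pf_sum g m / oddr m ^ c = pf_sum (\<lambda>k. \<Sum>m\<in>{1..k}. kern c k m * g m) m / oddr m ^ 2" for m
  proof (cases "c = 1")
    case True
    have "pf_sum g m / oddr m ^ c = pf_sum g m * oddr m / oddr m ^ 2"
      using True oddr_nonzero[of m] by (simp add: power2_eq_square)
    also have "pf_sum g m * oddr m = pf_sum (\<lambda>k. \<Sum>m\<in>{1..k}. kern c k m * g m) m"
      unfolding pf_sum_mult_odd
      by (intro pf_sum_cong sum.cong refl) (simp add: kern_def True Vsharp_ones_0 power2_eq_square)
    finally show ?thesis .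
  next
    case False
    \<comment> \<open>The exponent splits as c - 2 factors for the matrix power and 2 for the
      diagonal summation operator.\<close>
    hence c: "c = Suc (c - 3) + 2" using assms by simp
    have "pf_sum g m / oddr m ^ c = pf_sum g m / oddr m ^ Suc (c - 3) / oddr m ^ 2"
      by (subst c) (simp add: power_add power2_eq_square)
    thus ?thesis unfolding pf_sum_div_odd_pow using False by (simp add: kern_def)
  qed
  thus ?thesis by (simp only: sum_pf_sum_div_sq)
qed

section \<open>Truncated values\<close>

primrec tstar_trunc :: "nat list \<Rightarrow> nat \<Rightarrow> real" where
  "tstar_trunc [] n = 1"
| "tstar_trunc (s # ss) n = (\<Sum>m\<in>{1..n}. tstar_trunc ss m / oddr m ^ s)"

definition desc_lists :: "nat \<Rightarrow> nat \<Rightarrow> nat list set" where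
  "desc_lists d k = {ks. length ks = d \<and> sorted_wrt (\<ge>) (k # ks) \<and> (\<forall>x\<in>set ks. 1 \<le> x)}"

lemma desc_lists_0: "desc_lists 0 k = {[]}"
  by (auto simp: desc_lists_def)

lemma desc_lists_Suc:
  "desc_lists (Suc d) k = (\<lambda>(m, ks). m # ks) ` (SIGMA m:{1..k}. desc_lists d m)"
proof (intro set_eqI iffI)
  fix x assume "x \<in> desc_lists (Suc d) k"
  thus "x \<in> (\<lambda>(m, ks). m # ks) ` (SIGMA m:{1..k}. desc_lists d m)"
    by (cases x) (auto simp: desc_lists_def)
next
  fix x assume "x \<in> (\<lambda>(m, ks). m # ks) ` (SIGMA m:{1..k}. desc_lists d m)"
  thus "x \<in> desc_lists (Suc d) k"
    by (fastforce simp: desc_lists_def)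
qed

lemma finite_desc_lists: "finite (desc_lists d k)"
  by (induction d arbitrary: k) (auto simp: desc_lists_0 desc_lists_Suc)

lemma sum_desc_lists_Suc:
  fixes f :: "nat list \<Rightarrow> 'b :: comm_monoid_add"
  shows "sum f (desc_lists (Suc d) k) = (\<Sum>m\<in>{1..k}. \<Sum>ks\<in>desc_lists d m. f (m # ks))"
  unfolding desc_lists_Suc by (rule sum_Cons_Sigma) (auto simp: finite_desc_lists)

text \<open>The weight of a path k_0 >= ... >= k_d. The summation that follows each matrix power
  contributes 1/(2k_(i-1)-1)^2 to the upper end of the link, so the last variable carries no such
  factor.\<close>

primrec tail_wt :: "nat \<Rightarrow> (nat \<Rightarrow> nat) \<Rightarrow> nat \<Rightarrow> nat list \<Rightarrow> real" where
  "tail_wt 0 c k ks = 1"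
| "tail_wt (Suc d) c k ks =
    kern (c 1) k (hd ks) / oddr k ^ 2 * tail_wt d (\<lambda>i. c (Suc i)) (hd ks) (tl ks)"

text \<open>Each 2 multiplies by the eigenvalue 1/(2k-1)^2. The restriction to n >= 1 matters: at n
  = 0 every \<open>pf_sum\<close> is 0, while the empty index has truncated value 1.\<close>

lemma tstar_trunc_replicate_2:
  assumes "\<And>n. 1 \<le> n \<Longrightarrow> tstar_trunc s n = pf_sum g n" "1 \<le> n"
  shows "tstar_trunc (replicate a 2 @ s) n = pf_sum (\<lambda>k. g k / oddr k ^ (2 * a)) n"
  using assms(2)
proof (induction a arbitrary: n)
  case 0
  thus ?case using assms(1) by simp
next
  case (Suc a)
  have "tstar_trunc (replicate (Suc a) 2 @ s) n =
      (\<Sum>m\<in>{1..n}. pf_sum (\<lambda>k. g k / oddr k ^ (2 * a)) m / oddr m ^ 2)"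
    by (auto intro!: sum.cong simp: Suc.IH)
  also have "\<dots> = pf_sum (\<lambda>k. g k / oddr k ^ (2 * Suc a)) n"
    unfolding sum_pf_sum_div_sq
    by (intro pf_sum_cong) (simp add: power2_eq_square mult_ac)
  finally show ?case .
qed

lemma idx_0: "idx 0 c [a] = replicate a 2"
  by (simp add: idx_def)

lemma idx_Suc:
  "idx (Suc d) c (a # as) = replicate a 2 @ c 1 # idx d (\<lambda>i. c (Suc i)) as"
proof -
  have 1: "[1..<Suc d + 1] = 1 # map Suc [1..<d + 1]"
    by (subst upt_conv_Cons) (auto simp: map_Suc_upt)
  show ?thesis unfolding idx_def 1 by (simp add: comp_def)
qed

lemma tstar_trunc_idx:
  assumes "\<forall>i\<in>{1..d}. 1 \<le> c i \<and> c i \<noteq> 2" "length as = d + 1" "1 \<le> n"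
  shows "tstar_trunc (idx d c as) n =
    pf_sum (\<lambda>k. \<Sum>ks\<in>desc_lists d k. tail_wt d c k ks * (\<Prod>i\<le>d. 1 / oddr ((k # ks) ! i) ^ (2 * as ! i))) n"
  using assms
proof (induction d arbitrary: c as n)
  case 0
  then obtain a where as: "as = [a]" by (cases as) auto
  show ?case unfolding as idx_0
    using tstar_trunc_replicate_2[of "[]" "\<lambda>_. 1" n a] 0 pf_sum_one by (simp add: desc_lists_0)
next
  case (Suc d)
  then obtain a as' where as: "as = a # as'" "length as' = d + 1" by (cases as) auto
  let ?c = "\<lambda>i. c (Suc i)"
  let ?g = "\<lambda>m. \<Sum>ks\<in>desc_lists d m. tail_wt d ?c m ks * (\<Prod>i\<le>d. 1 / oddr ((m # ks) ! i) ^ (2 * as' ! i))"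
  have IH: "tstar_trunc (idx d ?c as') m = pf_sum ?g m" if "1 \<le> m" for m
    using Suc.IH[of ?c as' m] Suc.prems(1) as that by auto
  have "tstar_trunc (c 1 # idx d ?c as') n =
      pf_sum (\<lambda>k. (\<Sum>m\<in>{1..k}. kern (c 1) k m * ?g m) / oddr k ^ 2) n" for n
    using sum_pf_sum_div_pow[of "c 1" ?g n] Suc.prems(1) by (simp add: IH)
  from tstar_trunc_replicate_2[OF this \<open>1 \<le> n\<close>]
  have "tstar_trunc (idx (Suc d) c as) n =
      pf_sum (\<lambda>k. (\<Sum>m\<in>{1..k}. kern (c 1) k m * ?g m) / oddr k ^ 2 / oddr k ^ (2 * a)) n"
    unfolding as idx_Suc .
  also have "\<dots> = pf_sum (\<lambda>k. \<Sum>ks\<in>desc_lists (Suc d) k. tail_wt (Suc d) c k ks *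
      (\<Prod>i\<le>Suc d. 1 / oddr ((k # ks) ! i) ^ (2 * as ! i))) n"
    unfolding as sum_desc_lists_Suc prod.atMost_Suc_shift
    by (intro pf_sum_cong)
       (simp add: sum_distrib_left sum_distrib_right sum_divide_distrib mult_ac)
  finally show ?case .
qed

section \<open>Passage to the limit\<close>

text \<open>Multiplied by the classical Wallis product \<open>W\<close> with limit pi/2, it
  telescopes to 4n/(2n+1), which tends to 2.\<close>

lemma wallis_prod_tendsto: "wallis_prod \<longlonglongrightarrow> 4 / pi"
proof -
  define W where "W = (\<lambda>n. \<Prod>k=1..n. (4*real k^2) / (4*real k^2 - 1))"
  have W_pos: "W n > 0" for n
  proof -
    have "0 < 4 * (real k)\<^sup>2 - 1" if "1 \<le> k" for k
    proof -
      have "1 \<le> (real k)\<^sup>2" using that by (simp add: one_le_power)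
      thus ?thesis by simp
    qed
    thus ?thesis unfolding W_def by (intro prod_pos) auto
  qed
  have "wallis_prod n * W n = 4 * real n / (2 * real n + 1)" if "1 \<le> n" for n
    using that
  proof (induction n rule: dec_induct)
    case base
    show ?case by (simp add: wallis_prod_def W_def)
  next
    case (step n)
    have key: "4 * x / (2 * x + 1) * ((2 * x + 1)\<^sup>2 / (4 * x * (x + 1)) *
        (4 * (x + 1)\<^sup>2 / ((2 * x + 1) * (2 * x + 3)))) = 4 * (x + 1) / (2 * x + 3)"
      if "x > 0" for x :: real
      using that by (simp add: divide_simps power2_eq_square)
    have "{2..Suc n} = insert (Suc n) {2..n}" using step by auto
    hence "wallis_prod (Suc n) * W (Suc n) =
      (wallis_prod n * W n) * (oddr (Suc n) ^ 2 / (oddr (Suc n) ^ 2 - 1) *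
         (4 * real (Suc n) ^ 2 / (4 * real (Suc n) ^ 2 - 1)))"
      by (simp add: wallis_prod_def W_def)
    also have "oddr (Suc n) ^ 2 - 1 = 4 * real n * (real n + 1)"
      by (simp add: oddr_def power2_eq_square algebra_simps)
    also have "4 * real (Suc n) ^ 2 - 1 = (2 * real n + 1) * (2 * real n + 3)"
      by (simp add: power2_eq_square algebra_simps)
    also have "oddr (Suc n) = 2 * real n + 1" by (simp add: oddr_def)
    also have "wallis_prod n * W n = 4 * real n / (2 * real n + 1)" by (rule step.IH)
    also have "4 * real n / (2 * real n + 1) * ((2 * real n + 1)\<^sup>2 / (4 * real n * (real n + 1)) *
        (4 * (real (Suc n))\<^sup>2 / ((2 * real n + 1) * (2 * real n + 3)))) = 4 * real (Suc n) / (2 * real (Suc n) + 1)"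
      using step key[of "real n"] by (simp add: add_ac)
    finally show ?case .
  qed
  hence "eventually (\<lambda>n. 4 * real n / (2 * real n + 1) / W n = wallis_prod n) sequentially"
    using W_pos by (intro eventually_sequentiallyI[of 1]) (metis less_irrefl nonzero_eq_divide_eq)
  moreover have "(\<lambda>n. 4 * real n / (2 * real n + 1) / W n) \<longlonglongrightarrow> 2 / (pi / 2)"
    unfolding W_def by (intro tendsto_divide wallis) (real_asymp, simp)
  ultimately show ?thesis
    by (auto dest: Lim_transform_eventually)
qed

lemma pf_weight_tendsto: "1 \<le> k \<Longrightarrow> (\<lambda>n. pf_weight n k) \<longlonglongrightarrow> 4 / pi"
proof (induction k rule: dec_induct)
  case base
  show ?case using wallis_prod_tendsto by (simp add: pf_weight_def)
next
  case (step k)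
  have "(\<lambda>n. (real n - real k) / (real n + real k)) \<longlonglongrightarrow> 1" by real_asymp
  from tendsto_mult[OF step.IH this] show ?case using step by (simp add: pf_weight_Suc)
qed

text \<open>For k <= n every ratio (n-j)/(n+j) lies between 0 and 1, so a bound on
  \<open>wallis_prod\<close> is uniform in k. This is the domination for Tannery's theorem.\<close>

lemma pf_weight_bounded:
  obtains C where "C > 0" "\<And>n k. k \<le> n \<Longrightarrow> \<bar>pf_weight n k\<bar> \<le> C"
proof -
  have "Bseq wallis_prod"
    using wallis_prod_tendsto by (intro convergent_imp_Bseq) (auto simp: convergent_def)
  then obtain C where C: "C > 0" "\<And>n. norm (wallis_prod n) \<le> C"
    by (auto simp: Bseq_def)
  have "\<bar>pf_weight n k\<bar> \<le> C" if "k \<le> n" for n k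
  proof -
    have "\<bar>\<Prod>j\<in>{1..<k}. (real n - real j) / (real n + real j)\<bar> =
        (\<Prod>j\<in>{1..<k}. \<bar>(real n - real j) / (real n + real j)\<bar>)"
      by (rule abs_prod)
    also have "\<dots> \<le> 1"
      using that by (intro prod_le_1) (auto simp: divide_le_eq_1)
    finally have "\<bar>wallis_prod n\<bar> * \<bar>\<Prod>j\<in>{1..<k}. (real n - real j) / (real n + real j)\<bar> \<le> C * 1"
      using C by (intro mult_mono) auto
    thus ?thesis by (simp add: pf_weight_def abs_mult)
  qed
  with C(1) show ?thesis using that by blast
qed

definition lim_coeff :: "nat \<Rightarrow> real" where
  "lim_coeff k = (-1) ^ Suc k / oddr k * (4 / pi)"

lemma pf_sum_tendsto:
  assumes "summable (\<lambda>k. \<bar>g k\<bar> / \<bar>oddr k\<bar>)"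
  shows "pf_sum g \<longlonglongrightarrow> (\<Sum>k. if 1 \<le> k then lim_coeff k * g k else 0)"
proof -
  obtain C where C: "C > 0" "\<And>n k. k \<le> n \<Longrightarrow> \<bar>pf_weight n k\<bar> \<le> C"
    using pf_weight_bounded by blast
  define a where "a = (\<lambda>k n. if k \<in> {1..n} then pf_coeff n k * g k else 0)"
  have "((\<lambda>n. a k n) \<longlonglongrightarrow> (if 1 \<le> k then lim_coeff k * g k else 0))" for k
  proof (cases "1 \<le> k")
    case True
    have "(\<lambda>n. (-1) ^ Suc k / oddr k * pf_weight n k * g k) \<longlonglongrightarrow> lim_coeff k * g k"
      unfolding lim_coeff_def by (intro tendsto_intros pf_weight_tendsto True)
    moreover have "eventually (\<lambda>n. (-1) ^ Suc k / oddr k * pf_weight n k * g k = a k n) sequentially"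
      using True by (intro eventually_sequentiallyI[of k]) (simp add: a_def pf_coeff_def)
    ultimately show ?thesis using True by (auto dest: Lim_transform_eventually)
  qed (simp add: a_def)
  moreover have "eventually (\<lambda>(k,n). norm (a k n) \<le> C * (\<bar>g k\<bar> / \<bar>oddr k\<bar>)) (at_top \<times>\<^sub>F sequentially)"
  proof (intro always_eventually allI, clarify)
    fix k n
    have "\<bar>pf_weight n k\<bar> * (\<bar>g k\<bar> / \<bar>oddr k\<bar>) \<le> C * (\<bar>g k\<bar> / \<bar>oddr k\<bar>)" if "k \<le> n"
      using C that by (intro mult_right_mono) auto
    thus "norm (a k n) \<le> C * (\<bar>g k\<bar> / \<bar>oddr k\<bar>)"
      using C(1) by (auto simp: a_def pf_coeff_def abs_mult power_abs mult_ac)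
  qed
  moreover have "summable (\<lambda>k. C * (\<bar>g k\<bar> / \<bar>oddr k\<bar>))"
    using assms by (rule summable_mult)
  ultimately have "(\<lambda>n. suminf (\<lambda>k. a k n)) \<longlonglongrightarrow> (\<Sum>k. if 1 \<le> k then lim_coeff k * g k else 0)"
    by (rule tannerys_theorem[THEN conjunct2, THEN conjunct2]) simp
  moreover have "suminf (\<lambda>k. a k n) = pf_sum g n" for n
    unfolding pf_sum_def by (subst suminf_finite[of "{1..n}"]) (auto simp: a_def)
  ultimately show ?thesis by simp
qed

lemma sum_desc_lists_eq_tstar_trunc:
  "(\<Sum>ks\<in>desc_lists (length s) n. \<Prod>j<length s. 1 / oddr (ks ! j) ^ (s ! j)) = tstar_trunc s n"
proof (induction s arbitrary: n)
  case (Cons a s)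
  show ?case
    by (simp add: sum_desc_lists_Suc prod.lessThan_Suc_shift Cons.IH[symmetric] sum_divide_distrib
             del: prod.lessThan_Suc)
qed (simp add: desc_lists_0)

text \<open>All terms are nonnegative and every finite set of lists lies below some truncation
  bound. The limit thus bounds all finite sums, so that \<open>infsum\<close> is a genuine value and
  not the default 0.\<close>

lemma tstar_eqI:
  assumes "tstar_trunc s \<longlonglongrightarrow> L"
  shows "tstar s = L"
proof -
  define D where "D = {ks :: nat list. length ks = length s \<and> sorted_wrt (\<ge>) ks \<and> (\<forall>k\<in>set ks. 1 \<le> k)}"
  define f where "f = (\<lambda>ks. \<Prod>j<length s. 1 / oddr (ks ! j) ^ (s ! j))"
  have trunc: "sum f (desc_lists (length s) n) = tstar_trunc s n" for n
    unfolding f_def by (rule sum_desc_lists_eq_tstar_trunc)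
  have sub: "desc_lists (length s) n \<subseteq> D" for n
    by (auto simp: desc_lists_def D_def)
  have nonneg: "f ks \<ge> 0" if "ks \<in> D" for ks
    unfolding f_def using that by (intro prod_nonneg) (auto simp: D_def oddr_pos less_imp_le)
  have mono: "incseq (tstar_trunc s)"
  proof (rule incseq_SucI)
    fix n
    have "desc_lists (length s) n \<subseteq> desc_lists (length s) (Suc n)"
      by (auto simp: desc_lists_def le_Suc_eq)
    thus "tstar_trunc s n \<le> tstar_trunc s (Suc n)"
      unfolding trunc[symmetric] using sub nonneg
      by (intro sum_mono2) (auto simp: finite_desc_lists)
  qed
  have le: "tstar_trunc s n \<le> L" for n
    using incseq_le[OF mono assms] .
  have fin: "sum f F \<le> L" if F: "finite F" "F \<subseteq> D" for F
  proof -
    have "finite (\<Union>(set ` F))" using F by auto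
    then obtain n where n: "\<forall>x\<in>\<Union>(set ` F). x \<le> n"
      using finite_nat_set_iff_bounded_le by metis
    hence "F \<subseteq> desc_lists (length s) n"
      using F by (auto simp: desc_lists_def D_def)
    hence "sum f F \<le> sum f (desc_lists (length s) n)"
      using sub nonneg by (intro sum_mono2) (auto simp: finite_desc_lists)
    thus ?thesis using le[of n] trunc by simp
  qed
  have summable: "f summable_on D"
    using nonneg fin by (intro nonneg_bdd_above_summable_on bdd_aboveI2[of _ _ L]) auto
  have "infsum f D \<le> L" by (rule infsum_le_finite_sums[OF summable fin])
  moreover have "L \<le> infsum f D"
  proof (rule LIMSEQ_le_const2[OF assms], intro exI allI impI)
    fix n
    show "tstar_trunc s n \<le> infsum f D"
      unfolding trunc[symmetric]
      by (rule finite_sum_le_infsum[OF summable finite_desc_lists sub]) (use nonneg in auto)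
  qed
  ultimately show ?thesis by (simp add: tstar_def D_def f_def)
qed

section \<open>Absolute convergence through odd harmonic numbers\<close>

definition odd_harm :: "nat \<Rightarrow> real" where
  "odd_harm k = (\<Sum>l\<in>{1..k}. 1 / oddr l)"

lemma odd_harm_mono: "l \<le> k \<Longrightarrow> odd_harm l \<le> odd_harm k"
  unfolding odd_harm_def using oddr_pos by (intro sum_mono2) (auto simp: less_imp_le)

lemma odd_harm_nonneg: "0 \<le> odd_harm k"
  unfolding odd_harm_def using oddr_pos by (intro sum_nonneg) (auto simp: less_imp_le)

lemma odd_harm_ge_1: "1 \<le> k \<Longrightarrow> 1 \<le> odd_harm k"
  using odd_harm_mono[of 1 k] by (simp add: odd_harm_def oddr_def)

lemma odd_harm_le_harm: "odd_harm k \<le> harm k"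
  unfolding odd_harm_def harm_def
  by (intro sum_mono) (auto simp: oddr_def inverse_eq_divide intro!: divide_left_mono mult_pos_pos)

lemma summable_odd_harm_pow: "summable (\<lambda>k. odd_harm k ^ p / oddr k ^ 2)"
proof (rule summable_comparison_test_ev)
  show "summable (\<lambda>k. (1 + ln (real k)) ^ p / (real k) ^ 2)"
  proof (rule summable_comparison_test_bigo)
    show "summable (\<lambda>k. norm (real k powr (-3/2)))" by (simp add: summable_real_powr_iff)
    show "(\<lambda>k. (1 + ln (real k)) ^ p / (real k) ^ 2) \<in> O(\<lambda>k. real k powr (-3/2))"
      by real_asymp
  qed
  show "eventually (\<lambda>k. norm (odd_harm k ^ p / oddr k ^ 2) \<le> (1 + ln (real k)) ^ p / (real k) ^ 2) sequentially"
  proof (intro eventually_sequentiallyI[of 1])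
    fix k :: nat assume k: "1 \<le> k"
    \<comment> \<open>The decreasing sequence in the library starts at \<open>Suc 0\<close>, hence
      the indices 0 and k - 1.\<close>
    have "harm k - ln (real k) \<le> harm 1 - ln 1"
      using decseqD[OF decseq_harm_diff_ln, of 0 "k - 1"] k by simp
    hence "odd_harm k \<le> 1 + ln (real k)"
      using odd_harm_le_harm[of k] by (simp add: harm_def)
    moreover have "real k \<le> oddr k" using k by (simp add: oddr_def)
    ultimately show "norm (odd_harm k ^ p / oddr k ^ 2) \<le> (1 + ln (real k)) ^ p / (real k) ^ 2"
      using k odd_harm_nonneg[of k]
      by (auto intro!: frac_le power_mono simp: abs_mult)
  qed
qed

text \<open>Each of the r + 1 links costs at most a factor 2, and each of the r inner variables is
  summed against 1/(2l-1).\<close>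

lemma abs_Vsharp_ones_le:
  assumes "1 \<le> m" "m \<le> k"
  shows "\<bar>Vsharp k m (replicate r 1)\<bar> \<le> 2 ^ Suc r * (oddr k / oddr m) * odd_harm k ^ r"
  using assms(2)
proof (induction r arbitrary: k)
  case 0
  have "oddr k > 0" "oddr m > 0" using 0 assms by (auto intro: oddr_pos)
  thus ?case using 0 by (auto simp: Vsharp_ones_0 two_pow_tri abs_mult)
next
  case (Suc r)
  have pos: "oddr k > 0" "oddr m > 0" using Suc.prems assms by (auto intro: oddr_pos)
  have "\<bar>Vsharp k m (replicate (Suc r) 1)\<bar> \<le>
      (\<Sum>l\<in>{m..k}. \<bar>2 ^ tri k l * oddr k / oddr l ^ 2 * Vsharp l m (replicate r 1)\<bar>)"
    unfolding Vsharp_ones_Suc[OF Suc.prems] by (rule sum_abs)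
  also have "\<dots> \<le> (\<Sum>l\<in>{m..k}. 2 ^ Suc (Suc r) * (oddr k / oddr m) * odd_harm k ^ r * (1 / oddr l))"
  proof (rule sum_mono)
    fix l assume l: "l \<in> {m..k}"
    have lpos: "oddr l > 0" using l assms by (auto intro: oddr_pos)
    have "\<bar>2 ^ tri k l * oddr k / oddr l ^ 2 * Vsharp l m (replicate r 1)\<bar> =
        2 ^ tri k l * (oddr k / oddr l ^ 2) * \<bar>Vsharp l m (replicate r 1)\<bar>"
      using pos lpos by (simp add: abs_mult)
    also have "\<dots> \<le> 2 * (oddr k / oddr l ^ 2) * (2 ^ Suc r * (oddr l / oddr m) * odd_harm k ^ r)"
    proof (rule mult_mono)
      have "\<bar>Vsharp l m (replicate r 1)\<bar> \<le> 2 ^ Suc r * (oddr l / oddr m) * odd_harm l ^ r"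
        using Suc.IH[of l] l by simp
      also have "\<dots> \<le> 2 ^ Suc r * (oddr l / oddr m) * odd_harm k ^ r"
        using pos lpos l by (intro mult_left_mono power_mono odd_harm_mono odd_harm_nonneg) auto
      finally show "\<bar>Vsharp l m (replicate r 1)\<bar> \<le> 2 ^ Suc r * (oddr l / oddr m) * odd_harm k ^ r" .
    qed (use pos lpos in \<open>auto simp: two_pow_tri intro!: mult_right_mono divide_right_mono\<close>)
    also have "\<dots> = 2 ^ Suc (Suc r) * (oddr k / oddr m) * odd_harm k ^ r * (1 / oddr l)"
      using lpos pos by (simp add: field_simps power2_eq_square)
    finally show "\<bar>2 ^ tri k l * oddr k / oddr l ^ 2 * Vsharp l m (replicate r 1)\<bar> \<le> \<dots>" .
  qed
  also have "\<dots> = 2 ^ Suc (Suc r) * (oddr k / oddr m) * odd_harm k ^ r * (\<Sum>l\<in>{m..k}. 1 / oddr l)"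
    by (rule sum_distrib_left[symmetric])
  also have "\<dots> \<le> 2 ^ Suc (Suc r) * (oddr k / oddr m) * odd_harm k ^ r * odd_harm k"
  proof (rule mult_left_mono)
    show "(\<Sum>l\<in>{m..k}. 1 / oddr l) \<le> odd_harm k"
      unfolding odd_harm_def using assms oddr_pos by (intro sum_mono2) (auto simp: less_imp_le)
  qed (use pos odd_harm_nonneg in auto)
  finally show ?case by (simp add: mult_ac)
qed

text \<open>The extra 1/(2k-1) is the decay that c >= 3 provides; it yields convergence in k_0 when
  u >= 1. The exponents are generous so that the same shape of bound also serves c = 1.\<close>

lemma abs_kern_le_strong:
  assumes "1 \<le> m" "m \<le> k" "3 \<le> c"
  shows "\<bar>kern c k m\<bar> / oddr k ^ 2 \<le> 2 ^ c * odd_harm k ^ c / oddr m / oddr k"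
proof -
  have pos: "oddr k > 0" "oddr m \<ge> 1" using assms by (auto intro: oddr_pos oddr_ge_1)
  have h: "odd_harm k \<ge> 1" using assms by (intro odd_harm_ge_1) auto
  have "\<bar>kern c k m\<bar> / oddr k ^ 2 = \<bar>Vsharp k m (replicate (c - 3) 1)\<bar> / (oddr m * oddr k ^ 2)"
    using assms pos by (simp add: kern_def abs_mult)
  also have "\<dots> \<le> 2 ^ Suc (c - 3) * (oddr k / oddr m) * odd_harm k ^ (c - 3) / (oddr m * oddr k ^ 2)"
    using pos by (intro divide_right_mono abs_Vsharp_ones_le assms) auto
  also have "\<dots> = 2 ^ Suc (c - 3) * odd_harm k ^ (c - 3) * (1 / oddr m / oddr k) / oddr m"
    using pos by (simp add: field_simps power2_eq_square)
  also have "\<dots> \<le> 2 ^ c * odd_harm k ^ c * (1 / oddr m / oddr k) / 1"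
    using pos h assms
    by (intro frac_le mult_mono power_increasing mult_nonneg_nonneg) auto
  finally show ?thesis by simp
qed

lemma abs_kern_le:
  assumes "1 \<le> m" "m \<le> k" "1 \<le> c" "c \<noteq> 2"
  shows "\<bar>kern c k m\<bar> / oddr k ^ 2 \<le> 2 ^ c * odd_harm k ^ c / oddr m"
proof (cases "c = 1")
  case True
  have pos: "oddr k > 0" "oddr m > 0" using assms by (auto intro: oddr_pos)
  have "\<bar>kern c k m\<bar> / oddr k ^ 2 = 2 ^ tri k m / oddr m"
    using pos assms True by (simp add: kern_def Vsharp_ones_0 abs_mult power2_eq_square)
  also have "\<dots> \<le> 2 ^ c * odd_harm k ^ c / oddr m"
    using pos True odd_harm_ge_1[of k] assms by (intro divide_right_mono) (auto simp: two_pow_tri)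
  finally show ?thesis .
next
  case False
  have pos: "oddr k \<ge> 1" "oddr m > 0" using assms by (auto intro: oddr_pos oddr_ge_1)
  have "\<bar>kern c k m\<bar> / oddr k ^ 2 \<le> 2 ^ c * odd_harm k ^ c / oddr m / oddr k"
    using False assms by (intro abs_kern_le_strong) auto
  also have "\<dots> \<le> 2 ^ c * odd_harm k ^ c / oddr m / 1"
    using pos odd_harm_nonneg[of k] by (intro divide_left_mono) auto
  finally show ?thesis by simp
qed

definition tail_mass :: "nat \<Rightarrow> (nat \<Rightarrow> nat) \<Rightarrow> nat \<Rightarrow> real" where
  "tail_mass d c k = (\<Sum>ks\<in>desc_lists d k. \<bar>tail_wt d c k ks\<bar>)"

lemma tail_mass_Suc:
  "1 \<le> k \<Longrightarrow> tail_mass (Suc d) c k =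
    (\<Sum>m\<in>{1..k}. \<bar>kern (c 1) k m\<bar> / oddr k ^ 2 * tail_mass d (\<lambda>i. c (Suc i)) m)"
  by (simp add: tail_mass_def sum_desc_lists_Suc abs_mult sum_distrib_left)

text \<open>\<open>B\<close> may depend on the given k, so it can hold the powers of
  \<open>odd_harm k\<close> and the decay from the kernel; summing 1/(2m-1) over m <= k adds one
  more harmonic factor.\<close>

lemma tail_mass_Suc_le:
  assumes "\<And>m. 1 \<le> m \<Longrightarrow> m \<le> k \<Longrightarrow> \<bar>kern (c 1) k m\<bar> / oddr k ^ 2 \<le> B / oddr m" "0 \<le> B"
    and "\<And>m. 1 \<le> m \<Longrightarrow> tail_mass d (\<lambda>i. c (Suc i)) m \<le> C * odd_harm m ^ p" "0 \<le> C" "1 \<le> k"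
  shows "tail_mass (Suc d) c k \<le> B * C * odd_harm k ^ Suc p"
proof -
  have "tail_mass (Suc d) c k \<le> (\<Sum>m\<in>{1..k}. B / oddr m * (C * odd_harm k ^ p))"
    unfolding tail_mass_Suc[OF \<open>1 \<le> k\<close>]
  proof (intro sum_mono mult_mono)
    fix m assume m: "m \<in> {1..k}"
    show "\<bar>kern (c 1) k m\<bar> / oddr k ^ 2 \<le> B / oddr m" using assms m by auto
    have "C * odd_harm m ^ p \<le> C * odd_harm k ^ p"
      using m assms by (intro mult_left_mono power_mono odd_harm_mono odd_harm_nonneg) auto
    thus "tail_mass d (\<lambda>i. c (Suc i)) m \<le> C * odd_harm k ^ p"
      using assms(3)[of m] m by simp
    show "0 \<le> B / oddr m" using assms oddr_pos[of m] m by simp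
    show "0 \<le> tail_mass d (\<lambda>i. c (Suc i)) m"
      unfolding tail_mass_def by (intro sum_nonneg) auto
  qed
  also have "\<dots> = B * C * odd_harm k ^ p * odd_harm k"
    unfolding odd_harm_def[of k] sum_distrib_left by (simp add: mult_ac)
  finally show ?thesis by (simp add: mult_ac)
qed

lemma tail_mass_le:
  assumes "\<forall>i\<in>{1..d}. 1 \<le> c i \<and> c i \<noteq> 2"
  obtains C p where "C \<ge> 0" "\<And>k. 1 \<le> k \<Longrightarrow> tail_mass d c k \<le> C * odd_harm k ^ p"
proof -
  have "\<exists>C p. C \<ge> 0 \<and> (\<forall>k\<ge>1. tail_mass d c k \<le> C * odd_harm k ^ p)"
    using assms
  proof (induction d arbitrary: c)
    case 0
    show ?case by (intro exI[of _ 1] exI[of _ 0]) (simp add: tail_mass_def desc_lists_0)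
  next
    case (Suc d)
    from Suc.IH[of "\<lambda>i. c (Suc i)"] Suc.prems obtain C p where C: "C \<ge> 0"
      "\<And>k. 1 \<le> k \<Longrightarrow> tail_mass d (\<lambda>i. c (Suc i)) k \<le> C * odd_harm k ^ p"
      by auto
    have "tail_mass (Suc d) c k \<le> (2 ^ c 1 * C) * odd_harm k ^ (c 1 + Suc p)" if "1 \<le> k" for k
      using tail_mass_Suc_le[of k c "2 ^ c 1 * odd_harm k ^ c 1" d C p]
        abs_kern_le[of _ k "c 1"] Suc.prems C that odd_harm_nonneg[of k]
      by (simp add: power_add mult_ac)
    thus ?case using C by (intro exI[of _ "2 ^ c 1 * C"] exI[of _ "c 1 + Suc p"]) auto
  qed
  thus ?thesis using that by blast
qed

lemma tail_mass_le_strong: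
  assumes "\<forall>i\<in>{1..d}. 1 \<le> c i \<and> c i \<noteq> 2" "3 \<le> c 1" "1 \<le> d"
  obtains C p where "C \<ge> 0" "\<And>k. 1 \<le> k \<Longrightarrow> tail_mass d c k \<le> C * odd_harm k ^ p / oddr k"
proof -
  obtain d' where d: "d = Suc d'" using assms(3) by (cases d) auto
  have "\<forall>i\<in>{1..d'}. 1 \<le> c (Suc i) \<and> c (Suc i) \<noteq> 2" using assms(1) d by auto
  then obtain C p where C: "C \<ge> 0"
      "\<And>k. 1 \<le> k \<Longrightarrow> tail_mass d' (\<lambda>i. c (Suc i)) k \<le> C * odd_harm k ^ p"
    by (rule tail_mass_le) blast
  have "tail_mass d c k \<le> (2 ^ c 1 * C) * odd_harm k ^ (c 1 + Suc p) / oddr k" if "1 \<le> k" for k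
    using tail_mass_Suc_le[of k c "2 ^ c 1 * odd_harm k ^ c 1 / oddr k" d' C p]
      abs_kern_le_strong[of _ k "c 1"] assms C that odd_harm_nonneg[of k] oddr_pos[of k]
    by (simp add: power_add mult_ac d)
  thus ?thesis using that[of "2 ^ c 1 * C" "c 1 + Suc p"] C by auto
qed

definition desc_all :: "nat \<Rightarrow> nat list set" where
  "desc_all d = {ks. length ks = d + 1 \<and> sorted_wrt (\<ge>) ks \<and> (\<forall>k\<in>set ks. 1 \<le> k)}"

lemma bij_betw_desc_all:
  "bij_betw (\<lambda>(k, ks). k # ks) (SIGMA k:{1..}. desc_lists d k) (desc_all d)"
proof (rule bij_betw_imageI)
  show "inj_on (\<lambda>(k, ks). k # ks) (SIGMA k:{1..}. desc_lists d k)"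
    by (auto simp: inj_on_def)
  show "(\<lambda>(k, ks). k # ks) ` (SIGMA k:{1..}. desc_lists d k) = desc_all d"
  proof (intro set_eqI iffI)
    fix x assume "x \<in> desc_all d"
    thus "x \<in> (\<lambda>(k, ks). k # ks) ` (SIGMA k:{1..}. desc_lists d k)"
      by (cases x) (auto simp: desc_lists_def desc_all_def)
  next
    fix x assume "x \<in> (\<lambda>(k, ks). k # ks) ` (SIGMA k:{1..}. desc_lists d k)"
    thus "x \<in> desc_all d"
      by (auto simp: desc_lists_def desc_all_def)
  qed
qed

definition spec_wt :: "nat \<Rightarrow> (nat \<Rightarrow> nat) \<Rightarrow> nat list \<Rightarrow> real" where
  "spec_wt d c ks = lim_coeff (hd ks) * tail_wt d c (hd ks) (tl ks)"

lemma abs_lim_coeff: "1 \<le> k \<Longrightarrow> \<bar>lim_coeff k\<bar> = 4 / pi / oddr k"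
  using oddr_pos[of k] by (simp add: lim_coeff_def abs_mult power_abs)

text \<open>For u = 0 the square comes from k_u = k_0 itself. For u >= 1 the factor at k_u is only
  bounded by 1, and the square is made of one 1/(2k_0-1) from \<open>lim_coeff\<close> and one from
  c_1 >= 3.\<close>

lemma sum_abs_spec_wt_le:
  assumes "\<forall>i\<in>{1..d}. 1 \<le> c i \<and> c i \<noteq> 2" "1 \<le> u \<longrightarrow> 3 \<le> c 1" "u \<le> d"
  obtains C p where
    "\<And>k. 1 \<le> k \<Longrightarrow> (\<Sum>ks\<in>desc_lists d k. \<bar>spec_wt d c (k # ks) / oddr ((k # ks) ! u) ^ 2\<bar>) \<le>
       C * (odd_harm k ^ p / oddr k ^ 2)"
proof (cases "u = 0")
  case True
  obtain C p where C: "C \<ge> 0" "\<And>k. 1 \<le> k \<Longrightarrow> tail_mass d c k \<le> C * odd_harm k ^ p"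
    using tail_mass_le[OF assms(1)] by blast
  have "(\<Sum>ks\<in>desc_lists d k. \<bar>spec_wt d c (k # ks) / oddr ((k # ks) ! u) ^ 2\<bar>) \<le>
      (4 / pi * C) * (odd_harm k ^ p / oddr k ^ 2)" if k: "1 \<le> k" for k
  proof -
    have o: "oddr k \<ge> 1" using k by (rule oddr_ge_1)
    have "(\<Sum>ks\<in>desc_lists d k. \<bar>spec_wt d c (k # ks) / oddr ((k # ks) ! u) ^ 2\<bar>) =
        4 / pi / oddr k * tail_mass d c k / oddr k ^ 2"
      using True k by (simp add: spec_wt_def abs_mult abs_lim_coeff tail_mass_def
          sum_distrib_left sum_divide_distrib)
    also have "\<dots> \<le> 4 / pi / 1 * (C * odd_harm k ^ p) / oddr k ^ 2"
      using o C k odd_harm_nonneg[of k]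
      by (intro divide_right_mono mult_mono divide_left_mono) (auto simp: tail_mass_def intro!: sum_nonneg)
    finally show ?thesis by simp
  qed
  thus ?thesis using that by blast
next
  case False
  obtain C p where C: "C \<ge> 0" "\<And>k. 1 \<le> k \<Longrightarrow> tail_mass d c k \<le> C * odd_harm k ^ p / oddr k"
    by (rule tail_mass_le_strong[of d c]) (use assms False in auto)
  have "(\<Sum>ks\<in>desc_lists d k. \<bar>spec_wt d c (k # ks) / oddr ((k # ks) ! u) ^ 2\<bar>) \<le>
      (4 / pi * C) * (odd_harm k ^ p / oddr k ^ 2)" if k: "1 \<le> k" for k
  proof -
    have o: "oddr k > 0" using k by (rule oddr_pos)
    have "(\<Sum>ks\<in>desc_lists d k. \<bar>spec_wt d c (k # ks) / oddr ((k # ks) ! u) ^ 2\<bar>) \<le>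
        (\<Sum>ks\<in>desc_lists d k. \<bar>lim_coeff k\<bar> * \<bar>tail_wt d c k ks\<bar>)"
    proof (rule sum_mono)
      fix ks assume ks: "ks \<in> desc_lists d k"
      have "(k # ks) ! u \<in> set (k # ks)" using ks assms by (intro nth_mem) (auto simp: desc_lists_def)
      hence "1 \<le> (k # ks) ! u" using ks k by (auto simp: desc_lists_def)
      hence "1 \<le> oddr ((k # ks) ! u) ^ 2" using oddr_ge_1 one_le_power by blast
      hence "\<bar>spec_wt d c (k # ks)\<bar> / oddr ((k # ks) ! u) ^ 2 \<le> \<bar>spec_wt d c (k # ks)\<bar> / 1"
        by (intro divide_left_mono) auto
      thus "\<bar>spec_wt d c (k # ks) / oddr ((k # ks) ! u) ^ 2\<bar> \<le> \<bar>lim_coeff k\<bar> * \<bar>tail_wt d c k ks\<bar>"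
        by (simp add: spec_wt_def abs_mult)
    qed
    also have "\<dots> = 4 / pi / oddr k * tail_mass d c k"
      using k by (simp add: abs_lim_coeff tail_mass_def sum_distrib_left)
    also have "\<dots> \<le> 4 / pi / oddr k * (C * odd_harm k ^ p / oddr k)"
      using o C k by (intro mult_left_mono) auto
    finally show ?thesis by (simp add: power2_eq_square)
  qed
  thus ?thesis using that by blast
qed

text \<open>The common majorant, used both for a single index and for the interchange of sums in the
  theorem.\<close>

lemma abs_summable_spec_wt:
  assumes "\<forall>i\<in>{1..d}. 1 \<le> c i \<and> c i \<noteq> 2" "1 \<le> u \<longrightarrow> 3 \<le> c 1" "u \<le> d"
  shows "(\<lambda>ks. norm (spec_wt d c ks / oddr (ks ! u) ^ 2)) summable_on desc_all d"
proof -
  let ?f = "\<lambda>ks. spec_wt d c ks / oddr (ks ! u) ^ 2"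
  obtain C p where C: "\<And>k. 1 \<le> k \<Longrightarrow>
      (\<Sum>ks\<in>desc_lists d k. \<bar>?f (k # ks)\<bar>) \<le> C * (odd_harm k ^ p / oddr k ^ 2)"
    using sum_abs_spec_wt_le[OF assms] by blast
  have "(\<lambda>k. odd_harm k ^ p / oddr k ^ 2) summable_on UNIV"
    by (rule summable_nonneg_imp_summable_on[OF summable_odd_harm_pow]) (simp add: odd_harm_nonneg)
  hence "(\<lambda>k. C * (odd_harm k ^ p / oddr k ^ 2)) summable_on {1..}"
    by (intro summable_on_cmult_right) (rule summable_on_subset_banach, auto)
  hence "(\<lambda>k. \<Sum>ks\<in>desc_lists d k. \<bar>?f (k # ks)\<bar>) summable_on {1..}"
    by (rule summable_on_comparison_test) (rule C, simp, simp add: sum_nonneg)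
  hence "(\<lambda>(k, ks). \<bar>?f (k # ks)\<bar>) summable_on (SIGMA k:{1..}. desc_lists d k)"
    by (intro summable_on_SigmaI[where g = "\<lambda>k. \<Sum>ks\<in>desc_lists d k. \<bar>?f (k # ks)\<bar>"])
       (auto intro!: has_sum_finite finite_desc_lists)
  hence "(\<lambda>ks. \<bar>?f ks\<bar>) summable_on desc_all d"
    using summable_on_reindex_bij_betw[OF bij_betw_desc_all[of d], of "\<lambda>ks. \<bar>?f ks\<bar>"]
    by (simp add: case_prod_unfold)
  thus ?thesis by simp
qed

lemma desc_all_nth: "ks \<in> desc_all d \<Longrightarrow> i \<le> d \<Longrightarrow> 1 \<le> ks ! i"
  by (auto simp: desc_all_def)

lemma tstar_idx_has_sum:
  assumes c: "\<forall>i\<in>{1..d}. 1 \<le> c i \<and> c i \<noteq> 2" "1 \<le> u \<longrightarrow> 3 \<le> c 1" "u \<le> d"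
    and as: "length as = d + 1" "1 \<le> as ! u"
  shows "((\<lambda>ks. spec_wt d c ks * (\<Prod>i\<le>d. 1 / oddr (ks ! i) ^ (2 * as ! i)))
    has_sum tstar (idx d c as)) (desc_all d)"
proof -
  define P where "P = (\<lambda>ks. \<Prod>i\<le>d. 1 / oddr (ks ! i) ^ (2 * as ! i))"
  define F where "F = (\<lambda>ks. spec_wt d c ks * P ks)"
  define g where "g = (\<lambda>k. \<Sum>ks\<in>desc_lists d k. tail_wt d c k ks * P (k # ks))"
  have P_le: "\<bar>P ks\<bar> \<le> 1 / oddr (ks ! u) ^ 2" if ks: "ks \<in> desc_all d" for ks
  proof -
    have o: "1 \<le> oddr (ks ! i)" if "i \<le> d" for i
      using desc_all_nth[OF ks that] by (rule oddr_ge_1)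
    have le_1: "1 / oddr (ks ! i) ^ (2 * as ! i) \<le> 1" if "i \<le> d" for i
      using one_le_power[OF o[OF that], of "2 * as ! i"] by simp
    have "\<bar>P ks\<bar> = (1 / oddr (ks ! u) ^ (2 * as ! u)) *
        (\<Prod>i\<in>{..d} - {u}. 1 / oddr (ks ! i) ^ (2 * as ! i))"
      unfolding P_def abs_prod using c(3) o
      by (subst prod.remove[of _ u]) (auto intro!: prod.cong)
    also have "\<dots> \<le> (1 / oddr (ks ! u) ^ 2) * 1"
    proof (intro mult_mono prod_le_1)
      have "oddr (ks ! u) ^ 2 \<le> oddr (ks ! u) ^ (2 * as ! u)"
        using o[OF c(3)] as(2) by (intro power_increasing) auto
      thus "1 / oddr (ks ! u) ^ (2 * as ! u) \<le> 1 / oddr (ks ! u) ^ 2"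
        using o[OF c(3)] by (intro divide_left_mono) auto
    qed (use o le_1 in \<open>auto intro!: prod_nonneg\<close>)
    finally show ?thesis by simp
  qed
  have abs: "(\<lambda>ks. norm (F ks)) summable_on desc_all d"
  proof (rule Infinite_Sum.abs_summable_on_comparison_test[OF abs_summable_spec_wt[OF c]])
    fix ks assume "ks \<in> desc_all d"
    from mult_left_mono[OF P_le[OF this], of "\<bar>spec_wt d c ks\<bar>"]
    show "norm (F ks) \<le> norm (spec_wt d c ks / oddr (ks ! u) ^ 2)"
      by (simp add: F_def abs_mult)
  qed
  define S where "S = infsum F (desc_all d)"
  have S: "(F has_sum S) (desc_all d)"
    unfolding S_def by (rule has_sum_infsum[OF abs_summable_summable[OF abs]])
  hence "((\<lambda>(k, ks). F (k # ks)) has_sum S) (SIGMA k:{1..}. desc_lists d k)"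
    using has_sum_reindex_bij_betw[OF bij_betw_desc_all[of d], of F] by (simp add: case_prod_unfold)
  hence S': "((\<lambda>k. lim_coeff k * g k) has_sum S) {1..}"
  proof (rule has_sum_SigmaD)
    fix k :: nat
    show "((\<lambda>y. case (k, y) of (k, ks) \<Rightarrow> F (k # ks)) has_sum lim_coeff k * g k) (desc_lists d k)"
      by (rule has_sum_finiteI) (auto simp: F_def g_def spec_wt_def sum_distrib_left mult_ac finite_desc_lists)
  qed
  hence S'': "((\<lambda>k. if 1 \<le> k then lim_coeff k * g k else 0) has_sum S) UNIV"
    by (rule has_sum_cong_neutral[THEN iffD1, rotated -1]) auto
  hence sums: "(\<lambda>k. if 1 \<le> k then lim_coeff k * g k else 0) sums S"
    by (rule has_sum_imp_sums)
  \<comment> \<open>Unconditional summability over chains gives back the domination hypothesis of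
    the limit lemma: \<open>lim_coeff\<close> has absolute value (4/pi)/(2k-1), and pi/4 removes the
    constant.\<close>
  have "(\<lambda>k. \<bar>if 1 \<le> k then lim_coeff k * g k else 0\<bar>) summable_on UNIV"
    using summable_on_iff_abs_summable_on_real[THEN iffD1, OF has_sum_imp_summable[OF S'']] by simp
  hence "summable (\<lambda>k. pi / 4 * \<bar>if 1 \<le> k then lim_coeff k * g k else 0\<bar>)"
    by (intro summable_mult summable_on_imp_summable)
  moreover have ev: "eventually (\<lambda>k. pi / 4 * \<bar>if 1 \<le> k then lim_coeff k * g k else 0\<bar> = \<bar>g k\<bar> / \<bar>oddr k\<bar>) sequentially"
    using oddr_pos by (intro eventually_sequentiallyI[of 1]) (auto simp: abs_mult abs_lim_coeff abs_of_pos)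
  ultimately have "summable (\<lambda>k. \<bar>g k\<bar> / \<bar>oddr k\<bar>)"
    using summable_cong[OF ev] by simp
  from pf_sum_tendsto[OF this] have "pf_sum g \<longlonglongrightarrow> S"
    using sums by (simp add: sums_iff)
  moreover have "eventually (\<lambda>n. pf_sum g n = tstar_trunc (idx d c as) n) sequentially"
    using tstar_trunc_idx[OF c(1) as(1)]
    by (intro eventually_sequentiallyI[of 1]) (simp add: g_def P_def)
  ultimately have "tstar_trunc (idx d c as) \<longlonglongrightarrow> S"
    by (rule Lim_transform_eventually)
  hence "tstar (idx d c as) = S" by (rule tstar_eqI)
  with S show ?thesis by (simp add: F_def P_def)
qed

section \<open>Generating functions\<close>

lemma has_sum_Times_mult:
  fixes f :: "'a \<Rightarrow> 'c :: {real_normed_field, banach}" and g :: "'b \<Rightarrow> 'c"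
  assumes "(f has_sum a) A" "(\<lambda>x. norm (f x)) summable_on A"
    and "(g has_sum b) B" "(\<lambda>x. norm (g x)) summable_on B"
  shows "((\<lambda>(x, y). f x * g y) has_sum a * b) (A \<times> B)"
    and "(\<lambda>(x, y). norm (f x * g y)) summable_on A \<times> B"
proof -
  show abs: "(\<lambda>(x, y). norm (f x * g y)) summable_on A \<times> B"
  proof (rule summable_on_SigmaI)
    show "((\<lambda>y. case (x, y) of (x, y) \<Rightarrow> norm (f x * g y)) has_sum
        norm (f x) * infsum (\<lambda>y. norm (g y)) B) B" for x
      using has_sum_cmult_right[OF has_sum_infsum[OF assms(4)], of "norm (f x)"]
      by (simp add: norm_mult)
    show "(\<lambda>x. norm (f x) * infsum (\<lambda>y. norm (g y)) B) summable_on A"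
      by (rule summable_on_cmult_left[OF assms(2)])
  qed simp
  show "((\<lambda>(x, y). f x * g y) has_sum a * b) (A \<times> B)"
  proof (rule has_sum_SigmaI)
    show "((\<lambda>y. case (x, y) of (x, y) \<Rightarrow> f x * g y) has_sum f x * b) B" for x
      using has_sum_cmult_right[OF assms(3)] by simp
    show "((\<lambda>x. f x * b) has_sum a * b) A"
      by (rule has_sum_cmult_left[OF assms(1)])
    show "(\<lambda>(x, y). f x * g y) summable_on A \<times> B"
      by (rule abs_summable_summable) (use abs in \<open>simp add: case_prod_unfold\<close>)
  qed
qed

lemma geometric_from_has_sum:
  fixes x :: "'c :: {real_normed_field, banach}"
  assumes "norm x < 1"
  shows "((\<lambda>n. x ^ n) has_sum (x ^ e / (1 - x))) {e..}"
    and "(\<lambda>n. norm (x ^ n)) summable_on {e..}"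
proof -
  have abs: "summable (\<lambda>n. norm (x ^ n))"
    using assms by (simp add: norm_power summable_geometric)
  have "((\<lambda>n. x ^ n) has_sum (1 / (1 - x))) UNIV"
    by (rule norm_summable_imp_has_sum[OF abs geometric_sums[OF assms]])
  from has_sum_cmult_right[OF this, of "x ^ e"]
  have "((\<lambda>n. x ^ (e + n)) has_sum (x ^ e / (1 - x))) UNIV"
    by (simp add: power_add)
  moreover have "bij_betw (\<lambda>n. e + n) UNIV {e..}"
    by (rule bij_betwI[where g = "\<lambda>n. n - e"]) auto
  ultimately show "((\<lambda>n. x ^ n) has_sum (x ^ e / (1 - x))) {e..}"
    using has_sum_reindex_bij_betw[of "\<lambda>n. e + n" UNIV "{e..}" "\<lambda>n. x ^ n"] by simp
  show "(\<lambda>n. norm (x ^ n)) summable_on {e..}"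
    by (rule summable_on_subset_banach[OF summable_nonneg_imp_summable_on[OF abs] subset_UNIV]) simp
qed

text \<open>The lower bounds \<open>e\<close> encode a_u >= 1. The field stays general because the
  lemma is applied to complex ratios and also to their norms, which yields the majorant.\<close>

lemma geometric_prod_has_sum:
  fixes x :: "nat \<Rightarrow> 'c :: {real_normed_field, banach}"
  assumes "\<forall>i\<le>d. norm (x i) < 1"
  defines "AS \<equiv> \<lambda>d (e :: nat \<Rightarrow> nat). {as. length as = d + 1 \<and> (\<forall>i\<le>d. e i \<le> as ! i)}"
  shows "((\<lambda>as. \<Prod>i\<le>d. x i ^ (as ! i)) has_sum (\<Prod>i\<le>d. x i ^ e i / (1 - x i))) (AS d e)
    \<and> (\<lambda>as. norm (\<Prod>i\<le>d. x i ^ (as ! i))) summable_on AS d e"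
  using assms(1)
proof (induction d arbitrary: x e)
  case 0
  have bij: "bij_betw (\<lambda>a. [a]) {e 0..} (AS 0 e)"
  proof (rule bij_betw_imageI)
    show "(\<lambda>a. [a]) ` {e 0..} = AS 0 e"
    proof (intro set_eqI iffI)
      fix y assume "y \<in> AS 0 e"
      thus "y \<in> (\<lambda>a. [a]) ` {e 0..}"
        by (cases y) (auto simp: AS_def)
    qed (auto simp: AS_def)
  qed (simp add: inj_on_def)
  show ?case
    using geometric_from_has_sum[of "x 0" "e 0"] 0
    unfolding has_sum_reindex_bij_betw[OF bij, symmetric] summable_on_reindex_bij_betw[OF bij, symmetric]
    by simp
next
  case (Suc d)
  let ?x = "\<lambda>i. x (Suc i)" and ?e = "\<lambda>i. e (Suc i)"
  have bij: "bij_betw (\<lambda>(a, as). a # as) ({e 0..} \<times> AS d ?e) (AS (Suc d) e)"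
  proof (rule bij_betw_imageI)
    show "(\<lambda>(a, as). a # as) ` ({e 0..} \<times> AS d ?e) = AS (Suc d) e"
    proof (intro set_eqI iffI)
      fix y assume y: "y \<in> AS (Suc d) e"
      then obtain a as where y': "y = a # as" by (cases y) (auto simp: AS_def)
      have "e i \<le> y ! i" if "i \<le> Suc d" for i using y that by (simp add: AS_def)
      from this[of 0] this[of "Suc i" for i] have "e 0 \<le> a" "\<forall>i\<le>d. ?e i \<le> as ! i"
        by (simp_all add: y')
      moreover have "length as = d + 1" using y by (simp add: AS_def y')
      ultimately have "(a, as) \<in> {e 0..} \<times> AS d ?e" by (simp add: AS_def)
      thus "y \<in> (\<lambda>(a, as). a # as) ` ({e 0..} \<times> AS d ?e)"
        unfolding y' by (rule rev_image_eqI) simp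
    next
      fix y assume "y \<in> (\<lambda>(a, as). a # as) ` ({e 0..} \<times> AS d ?e)"
      thus "y \<in> AS (Suc d) e"
        by (auto simp: AS_def nth_Cons split: nat.splits)
    qed
  qed (auto simp: inj_on_def)
  have IH: "((\<lambda>as. \<Prod>i\<le>d. ?x i ^ (as ! i)) has_sum (\<Prod>i\<le>d. ?x i ^ ?e i / (1 - ?x i))) (AS d ?e)"
    "(\<lambda>as. norm (\<Prod>i\<le>d. ?x i ^ (as ! i))) summable_on AS d ?e"
    using Suc.IH[of ?x ?e] Suc.prems by auto
  have "norm (x 0) < 1" using Suc.prems by simp
  from has_sum_Times_mult[OF geometric_from_has_sum[OF this, of "e 0"] IH]
  show ?case
    unfolding has_sum_reindex_bij_betw[OF bij, symmetric] summable_on_reindex_bij_betw[OF bij, symmetric]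
      prod.atMost_Suc_shift
    by (simp add: case_prod_unfold)
qed

text \<open>Separates the kernel into a factor in k and a factor in m, uniformly for c = 1 and c >=
  3. Each k_i then collects delta(c_i) from the link above it and delta(c_(i+1)) from the link
  below. For c = 1 the truncated subtraction c - 3 gives the empty index.\<close>

lemma kern_dlt:
  assumes "1 \<le> c" "c \<noteq> 2"
  shows "kern c k m = ((-1) ^ (k * dlt c) * oddr k ^ dlt c) * Vsharp k m (replicate (c - 3) 1) *
    ((-1) ^ (m * dlt c) * oddr m powi (int (dlt c) - 1))"
proof (cases "c = 1")
  case True
  thus ?thesis by (simp add: kern_def dlt_def power_add)
next
  case False
  thus ?thesis using assms by (simp add: kern_def dlt_def power_int_minus divide_inverse)
qed

lemma tail_wt_cong:
  "(\<And>i. 1 \<le> i \<Longrightarrow> i \<le> d \<Longrightarrow> c i = c' i) \<Longrightarrow> tail_wt d c k ks = tail_wt d c' k ks"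
proof (induction d arbitrary: c c' k ks)
  case (Suc d)
  have "tail_wt d (\<lambda>i. c (Suc i)) k ks = tail_wt d (\<lambda>i. c' (Suc i)) k ks" for k ks
    using Suc.prems by (intro Suc.IH) auto
  thus ?case using Suc.prems[of 1] by simp
qed simp

text \<open>
  The free factor v takes the place of V-sharp at i = 0, where k_(-1) is not part of the list;
  this is what lets the induction shift the index.
\<close>
lemma tail_wt_prod:
  fixes c :: "nat \<Rightarrow> nat" and v :: real
  defines "\<delta> \<equiv> \<lambda>c i. dlt (c i) + dlt (c (Suc i))"
  assumes "\<forall>i\<in>{1..d}. 1 \<le> c i \<and> c i \<noteq> 2" "c (Suc d) = 0" "length ks = d"
  shows "(-1) ^ (k * dlt (c 0)) * oddr k powi (int (dlt (c 0)) - 1) * v * tail_wt d c k ks =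
    (\<Prod>i\<le>d. (-1) ^ ((k # ks) ! i * \<delta> c i) * oddr ((k # ks) ! i) powi (int (\<delta> c i) - 1)
       / oddr ((k # ks) ! i) ^ 2 *
       (if i = 0 then v else Vsharp ((k # ks) ! (i - 1)) ((k # ks) ! i) (replicate (c i - 3) 1)))"
  using assms(2-)
proof (induction d arbitrary: c k ks v)
  case 0
  \<comment> \<open>The value delta(0) = 2 at the end of the chain cancels the factor 1/(2k_d-1)^2
    that the path weight does not contain.\<close>
  have "oddr k powi (int (dlt (c 0) + 2) - 1) = oddr k powi (int (dlt (c 0)) - 1) * oddr k ^ 2"
    using power_int_add[of "oddr k" "int (dlt (c 0)) - 1" 2] oddr_nonzero[of k] by (simp add: add_ac)
  thus ?case using 0 oddr_nonzero[of k] by (simp add: \<delta>_def dlt_def[of 0] power_add distrib_left power_mult)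
next
  case (Suc d)
  then obtain m ms where ks: "ks = m # ms" "length ms = d" by (cases ks) auto
  let ?c = "\<lambda>i. c (Suc i)"
  let ?V = "Vsharp k m (replicate (c 1 - 3) 1)"
  let ?a = "dlt (c 0)" and ?b = "dlt (c 1)"
  have pw: "oddr k powi (int (?a + ?b) - 1) = oddr k powi (int ?a - 1) * oddr k ^ ?b"
    using power_int_add[of "oddr k" "int ?a - 1" "int ?b"] oddr_nonzero[of k] by (simp add: algebra_simps)
  have "(\<Prod>i\<le>d. (-1) ^ ((m # ms) ! i * \<delta> ?c i) * oddr ((m # ms) ! i) powi (int (\<delta> ?c i) - 1)
       / oddr ((m # ms) ! i) ^ 2 *
       Vsharp ((k # m # ms) ! i) ((m # ms) ! i) (replicate (?c i - 3) 1)) =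
      (\<Prod>i\<le>d. (-1) ^ ((m # ms) ! i * \<delta> ?c i) * oddr ((m # ms) ! i) powi (int (\<delta> ?c i) - 1)
       / oddr ((m # ms) ! i) ^ 2 *
       (if i = 0 then ?V else Vsharp ((m # ms) ! (i - 1)) ((m # ms) ! i) (replicate (?c i - 3) 1)))"
    by (intro prod.cong refl) (auto simp: nth_Cons')
  also have "\<dots> = (-1) ^ (m * ?b) * oddr m powi (int ?b - 1) * ?V * tail_wt d ?c m ms"
    using Suc.IH[of ?c ms m ?V] Suc.prems ks by auto
  finally have tail: "(\<Prod>i\<le>d. (-1) ^ ((m # ms) ! i * \<delta> ?c i) * oddr ((m # ms) ! i) powi (int (\<delta> ?c i) - 1)
       / oddr ((m # ms) ! i) ^ 2 *
       Vsharp ((k # m # ms) ! i) ((m # ms) ! i) (replicate (?c i - 3) 1)) = \<dots>" .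
  have \<delta>_Suc: "\<delta> c (Suc i) = \<delta> ?c i" for i by (simp add: \<delta>_def)
  have \<delta>_0: "\<delta> c 0 = ?a + ?b" by (simp add: \<delta>_def)
  have kern: "kern (c 1) k m = ((-1) ^ (k * ?b) * oddr k ^ ?b) * ?V *
      ((-1) ^ (m * ?b) * oddr m powi (int ?b - 1))"
    using Suc.prems by (intro kern_dlt) auto
  have "(\<Prod>i\<le>Suc d. (-1) ^ ((k # ks) ! i * \<delta> c i) * oddr ((k # ks) ! i) powi (int (\<delta> c i) - 1)
       / oddr ((k # ks) ! i) ^ 2 *
       (if i = 0 then v else Vsharp ((k # ks) ! (i - 1)) ((k # ks) ! i) (replicate (c i - 3) 1))) =
     (-1) ^ (k * (?a + ?b)) * oddr k powi (int (?a + ?b) - 1) / oddr k ^ 2 * v *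
     ((-1) ^ (m * ?b) * oddr m powi (int ?b - 1) * ?V * tail_wt d ?c m ms)"
    unfolding prod.atMost_Suc_shift tail[symmetric] by (simp add: \<delta>_Suc \<delta>_0 ks(1))
  also have "\<dots> = (-1) ^ (k * ?a) * oddr k powi (int ?a - 1) * v * tail_wt (Suc d) c k ks"
    unfolding pw by (simp add: ks(1) kern[simplified] power_add distrib_left)
  finally show ?case by simp
qed

lemma spec_wt_prod:
  fixes d :: nat and c :: "nat \<Rightarrow> nat"
  defines "\<delta> \<equiv> \<lambda>i. dlt (cext d c i) + dlt (cext d c (i + 1))"
  assumes "\<forall>i\<in>{1..d}. 1 \<le> c i \<and> c i \<noteq> 2" "ks \<in> desc_all d"
  shows "spec_wt d c ks = 2 / pi *
    (\<Prod>i\<le>d. (-1) ^ (ks ! i * \<delta> i) * oddr (ks ! i) powi (int (\<delta> i) - 1) / oddr (ks ! i) ^ 2 *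
       Vsharp (if i = 0 then 0 else ks ! (i - 1)) (ks ! i) (replicate (cext d c i - 3) 1))"
proof -
  obtain k ms where ks: "ks = k # ms" "length ms = d" "1 \<le> k"
    using assms(3) by (cases ks) (auto simp: desc_all_def)
  let ?v = "Vsharp 0 k []"
  \<comment> \<open>With k_(-1) = 0 the odd number is -1, so V-sharp is -2/(2k_0-1). Together with
    2/pi and the sign (-1)^(k_0) from c_0 = 1 this is exactly \<open>lim_coeff\<close>.\<close>
  have v: "?v = - 2 / oddr k" using ks(3) by (simp add: Vsharp_def tri_def oddr_def)
  have "(\<Prod>i\<le>d. (-1) ^ (ks ! i * \<delta> i) * oddr (ks ! i) powi (int (\<delta> i) - 1) / oddr (ks ! i) ^ 2 *
       Vsharp (if i = 0 then 0 else ks ! (i - 1)) (ks ! i) (replicate (cext d c i - 3) 1)) =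
     (\<Prod>i\<le>d. (-1) ^ (ks ! i * \<delta> i) * oddr (ks ! i) powi (int (\<delta> i) - 1) / oddr (ks ! i) ^ 2 *
       (if i = 0 then ?v else Vsharp (ks ! (i - 1)) (ks ! i) (replicate (cext d c i - 3) 1)))"
    using ks by (intro prod.cong refl) (auto simp: cext_def)
  also have "\<dots> = (-1) ^ (k * dlt (cext d c 0)) * oddr k powi (int (dlt (cext d c 0)) - 1) * ?v *
      tail_wt d (cext d c) k ms"
    unfolding \<delta>_def ks(1) using assms(2) ks(2)
    by (subst tail_wt_prod) (auto simp: cext_def)
  also have "tail_wt d (cext d c) k ms = tail_wt d c k ms"
    by (rule tail_wt_cong) (simp add: cext_def)
  finally show ?thesis
    using v by (simp add: spec_wt_def lim_coeff_def ks(1) cext_def dlt_def mult_ac)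
qed

lemma prod_indicator_power:
  fixes y :: "nat \<Rightarrow> 'c :: comm_semiring_1"
  assumes "u \<le> d"
  shows "(\<Prod>i\<le>d. y i ^ (if i = u then 1 else 0)) = y u"
proof -
  have "(\<Prod>i\<le>d. y i ^ (if i = u then 1 else 0)) = (\<Prod>i\<le>d. if i = u then y i else 1)"
    by (intro prod.cong) auto
  thus ?thesis using assms by simp
qed

theorem theorem3p4:
  fixes d u :: nat and c :: "nat \<Rightarrow> nat" and z :: "nat \<Rightarrow> complex"
  assumes "u \<le> d"
    and "\<forall>i\<in>{1..d}. 1 \<le> c i \<and> c i \<noteq> 2"
    and "1 \<le> u \<longrightarrow> 3 \<le> c 1"
    and "\<forall>i\<le>d. norm (z i) < 1"
  shows "\<exists>S::complex.
    ((\<lambda>as. of_real (tstar (idx d c as)) * (\<Prod>i\<le>d. z i ^ (2 * as ! i)))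
       has_sum S) {as :: nat list. length as = d + 1 \<and> 1 \<le> as ! u}
  \<and> ((\<lambda>ks. z u ^ 2 * of_real (2 / pi) * (1 / of_real (oddr (ks ! u)) ^ 2) *
        (\<Prod>i\<le>d.
           let di = dlt (cext d c i) + dlt (cext d c (i + 1));
               kprev = (if i = 0 then 0 else ks ! (i - 1))
           in (-1) ^ (ks ! i * di) * of_real (oddr (ks ! i)) powi (int di - 1)
              / (of_real (oddr (ks ! i)) ^ 2 - z i ^ 2)
              * of_real (Vsharp kprev (ks ! i) (replicate (cext d c i - 3) 1))))
       has_sum S) {ks :: nat list. length ks = d + 1 \<and> sorted_wrt (\<ge>) ks \<and> (\<forall>k\<in>set ks. 1 \<le> k)}"
proof -
  define AS where "AS = {as :: nat list. length as = d + 1 \<and> 1 \<le> as ! u}"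
  define e :: "nat \<Rightarrow> nat" where "e = (\<lambda>i. if i = u then 1 else 0)"
  define x :: "nat list \<Rightarrow> nat \<Rightarrow> complex" where "x = (\<lambda>ks i. z i ^ 2 / of_real (oddr (ks ! i)) ^ 2)"
  define F where "F = (\<lambda>(ks, as). of_real (spec_wt d c ks) * (\<Prod>i\<le>d. x ks i ^ (as ! i)))"
  define G where "G = (\<lambda>ks. of_real (spec_wt d c ks) * (\<Prod>i\<le>d. x ks i ^ e i / (1 - x ks i)))"
  have AS_eq: "AS = {as. length as = d + 1 \<and> (\<forall>i\<le>d. e i \<le> as ! i)}"
    using assms(1) by (auto simp: AS_def e_def)
  have z_lt: "norm (z i) ^ 2 < 1" if "i \<le> d" for i
    using assms(4) that by (simp add: abs_square_less_1)
  have o: "1 \<le> oddr (ks ! i)" if "ks \<in> desc_all d" "i \<le> d" for ks i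
    using desc_all_nth[OF that] by (rule oddr_ge_1)
  have norm_x: "norm (x ks i) = norm (z i) ^ 2 / oddr (ks ! i) ^ 2" for ks i
    by (simp add: x_def norm_divide norm_power)
  have norm_x_le: "norm (x ks i) \<le> norm (z i) ^ 2" "norm (x ks i) \<le> 1 / oddr (ks ! i) ^ 2"
    if "ks \<in> desc_all d" "i \<le> d" for ks i
  proof -
    have "1 \<le> oddr (ks ! i) ^ 2" using o[OF that] by (rule one_le_power)
    thus "norm (x ks i) \<le> norm (z i) ^ 2"
      unfolding norm_x using divide_left_mono[of 1 "oddr (ks ! i) ^ 2" "norm (z i) ^ 2"]
        oddr_nonzero by simp
    show "norm (x ks i) \<le> 1 / oddr (ks ! i) ^ 2"
      unfolding norm_x using z_lt[OF that(2)] by (intro divide_right_mono) auto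
  qed
  have norm_x_lt: "norm (x ks i) < 1" if "ks \<in> desc_all d" "i \<le> d" for ks i
    using norm_x_le(1)[OF that] z_lt[OF that(2)] by simp

  have inner: "((\<lambda>as. F (ks, as)) has_sum G ks) AS" if "ks \<in> desc_all d" for ks
    using geometric_prod_has_sum[of d "x ks" e] norm_x_lt that
    unfolding F_def G_def AS_eq by (auto intro: has_sum_cmult_right)

  \<comment> \<open>Absolute summability on the product set makes both iterated sums equal. As
    2k_i-1 >= 1, the denominators of the geometric sums are bounded by \<open>?M\<close> uniformly
    in the chain, and the condition a_u >= 1 leaves the factor 1/(2k_u-1)^2 of the majorant.\<close>
  have "(\<lambda>(ks, as). norm (F (ks, as))) summable_on desc_all d \<times> AS"
  proof (rule summable_on_SigmaI)
    let ?g = "\<lambda>ks. \<bar>spec_wt d c ks\<bar> * (\<Prod>i\<le>d. norm (x ks i) ^ e i / (1 - norm (x ks i)))"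
    let ?M = "\<Prod>i\<le>d. 1 / (1 - norm (z i) ^ 2)"
    show "((\<lambda>as. case (ks, as) of (ks, as) \<Rightarrow> norm (F (ks, as))) has_sum ?g ks) AS"
      if "ks \<in> desc_all d" for ks
      using geometric_prod_has_sum[of d "\<lambda>i. norm (x ks i)" e] norm_x_lt that
      unfolding F_def AS_eq
      by (auto simp: norm_mult norm_power prod_norm[symmetric] intro!: has_sum_cmult_right)
    show "?g summable_on desc_all d"
    proof (rule summable_on_comparison_test)
      show "(\<lambda>ks. ?M * norm (spec_wt d c ks / oddr (ks ! u) ^ 2)) summable_on desc_all d"
        by (intro summable_on_cmult_right abs_summable_spec_wt assms)
      fix ks assume ks: "ks \<in> desc_all d"
      have "(\<Prod>i\<le>d. norm (x ks i) ^ e i / (1 - norm (x ks i))) =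
          norm (x ks u) * (\<Prod>i\<le>d. 1 / (1 - norm (x ks i)))"
        using prod_indicator_power[OF assms(1), of "\<lambda>i. norm (x ks i)"]
        by (simp add: prod_dividef e_def)
      also have "\<dots> \<le> 1 / oddr (ks ! u) ^ 2 * ?M"
      proof (intro mult_mono prod_mono)
        fix i assume "i \<in> {..d}"
        hence i: "i \<le> d" by simp
        show "0 \<le> 1 / (1 - norm (x ks i)) \<and> 1 / (1 - norm (x ks i)) \<le> 1 / (1 - norm (z i) ^ 2)"
          using norm_x_le(1)[OF ks i] norm_x_lt[OF ks i] z_lt[OF i] by (auto intro!: divide_left_mono)
      qed (use norm_x_le(2)[OF ks assms(1)] norm_x_lt[OF ks] in \<open>auto intro!: prod_nonneg simp: less_imp_le\<close>)
      finally have "?g ks \<le> \<bar>spec_wt d c ks\<bar> * (1 / oddr (ks ! u) ^ 2 * ?M)"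
        by (intro mult_left_mono) auto
      thus "?g ks \<le> ?M * norm (spec_wt d c ks / oddr (ks ! u) ^ 2)"
        by (simp add: abs_mult mult_ac)
      show "0 \<le> ?g ks"
        using norm_x_lt[OF ks] by (auto intro!: mult_nonneg_nonneg prod_nonneg simp: less_imp_le)
    qed
  qed auto
  hence "F summable_on desc_all d \<times> AS"
    by (intro abs_summable_summable[of F]) (simp add: case_prod_unfold)
  then obtain S where S: "(F has_sum S) (desc_all d \<times> AS)"
    by (auto simp: summable_on_def)

  have right: "(G has_sum S) (desc_all d)"
    using S inner by (rule has_sum_SigmaD)
  have left: "((\<lambda>as. of_real (tstar (idx d c as)) * (\<Prod>i\<le>d. z i ^ (2 * as ! i))) has_sum S) AS"
  proof (rule has_sum_SigmaD)
    show "((\<lambda>(as, ks). F (ks, as)) has_sum S) (AS \<times> desc_all d)"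
      using S has_sum_swap by blast
    fix as assume as: "as \<in> AS"
    have "((\<lambda>ks. of_real (spec_wt d c ks * (\<Prod>i\<le>d. 1 / oddr (ks ! i) ^ (2 * as ! i))) *
        (\<Prod>i\<le>d. z i ^ (2 * as ! i))) has_sum
        of_real (tstar (idx d c as)) * (\<Prod>i\<le>d. z i ^ (2 * as ! i))) (desc_all d)"
      using as assms unfolding AS_def
      by (intro has_sum_cmult_left has_sum_of_real tstar_idx_has_sum) auto
    also have "(\<lambda>ks. of_real (spec_wt d c ks * (\<Prod>i\<le>d. 1 / oddr (ks ! i) ^ (2 * as ! i))) *
        (\<Prod>i\<le>d. z i ^ (2 * as ! i))) = (\<lambda>ks. F (ks, as))"
      by (simp add: F_def x_def prod_dividef power_divide power_mult)
    finally show "((\<lambda>ks. case (as, ks) of (as, ks) \<Rightarrow> F (ks, as)) has_sum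
        of_real (tstar (idx d c as)) * (\<Prod>i\<le>d. z i ^ (2 * as ! i))) (desc_all d)"
      by simp
  qed

  have G_eq: "G ks = z u ^ 2 * of_real (2 / pi) * (1 / of_real (oddr (ks ! u)) ^ 2) *
        (\<Prod>i\<le>d.
           let di = dlt (cext d c i) + dlt (cext d c (i + 1));
               kprev = (if i = 0 then 0 else ks ! (i - 1))
           in (-1) ^ (ks ! i * di) * of_real (oddr (ks ! i)) powi (int di - 1)
              / (of_real (oddr (ks ! i)) ^ 2 - z i ^ 2)
              * of_real (Vsharp kprev (ks ! i) (replicate (cext d c i - 3) 1)))"
    if ks: "ks \<in> desc_all d" for ks
  proof -
    define \<delta> where "\<delta> = (\<lambda>i. dlt (cext d c i) + dlt (cext d c (i + 1)))"
    define V where "V = (\<lambda>i. Vsharp (if i = 0 then 0 else ks ! (i - 1)) (ks ! i) (replicate (cext d c i - 3) 1))"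
    define r where "r = (\<lambda>i. (-1) ^ (ks ! i * \<delta> i) * oddr (ks ! i) powi (int (\<delta> i) - 1))"
    have "spec_wt d c ks = 2 / pi * (\<Prod>i\<le>d. r i / oddr (ks ! i) ^ 2 * V i)"
      using spec_wt_prod[OF assms(2) ks] by (simp add: r_def V_def \<delta>_def)
    moreover have "(\<Prod>i\<le>d. x ks i ^ e i) = x ks u"
      using prod_indicator_power[OF assms(1), of "x ks"] by (simp add: e_def)
    ultimately have "G ks = x ks u * of_real (2 / pi) *
        (\<Prod>i\<le>d. of_real (r i / oddr (ks ! i) ^ 2 * V i) * (1 / (1 - x ks i)))"
      by (simp add: G_def prod.distrib prod_dividef mult_ac)
    also have "(\<Prod>i\<le>d. of_real (r i / oddr (ks ! i) ^ 2 * V i) * (1 / (1 - x ks i))) =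
        (\<Prod>i\<le>d. of_real (r i) / (of_real (oddr (ks ! i)) ^ 2 - z i ^ 2) * of_real (V i))"
    proof (intro prod.cong refl)
      fix i
      \<comment> \<open>The factor 1/(2k_i-1)^2 in the product form of the weight merges with the
        geometric sum into the denominator of the theorem.\<close>
      have "of_real (oddr (ks ! i)) ^ 2 - z i ^ 2 = of_real (oddr (ks ! i)) ^ 2 * (1 - x ks i)"
        using oddr_nonzero[of "ks ! i"] by (simp add: x_def right_diff_distrib)
      thus "of_real (r i / oddr (ks ! i) ^ 2 * V i) * (1 / (1 - x ks i)) =
          of_real (r i) / (of_real (oddr (ks ! i)) ^ 2 - z i ^ 2) * of_real (V i)"
        by simp
    qed
    finally show ?thesis
      by (simp add: x_def r_def V_def \<delta>_def Let_def)
  qed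
  from right have "((\<lambda>ks. z u ^ 2 * of_real (2 / pi) * (1 / of_real (oddr (ks ! u)) ^ 2) *
        (\<Prod>i\<le>d.
           let di = dlt (cext d c i) + dlt (cext d c (i + 1));
               kprev = (if i = 0 then 0 else ks ! (i - 1))
           in (-1) ^ (ks ! i * di) * of_real (oddr (ks ! i)) powi (int di - 1)
              / (of_real (oddr (ks ! i)) ^ 2 - z i ^ 2)
              * of_real (Vsharp kprev (ks ! i) (replicate (cext d c i - 3) 1)))) has_sum S) (desc_all d)"
    by (rule has_sum_cong[THEN iffD1, rotated]) (rule G_eq)
  with left show ?thesis unfolding AS_def desc_all_def by blast
qed

end
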